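(* Let $p$ be an odd prime, let $n\geq 3$, and let $G$ be a group of order $p^n$. If $G$ is not elementary abelian, then $$\delta(G)\leq \delta\bigl(M_p(1,1,1)\times C_p^{\,n-3}\bigr).$$
   Context: For a finite group $G$, $\delta(G)$ denotes the number of all non-cyclic subgroups of $G$ (including $G$ itself if it is non-cyclic). $M_p(1,1,1)$ denotes the non-abelian group of order $p^3$ and exponent $p$ ($p$ odd). $C_p$ is the cyclic group of order $p$, and $C_p^{\,d}$ is the direct product of $d$ copies of $C_p$ (trivial if $d=0$). *)

theory Defs
  imports "HOL-Algebra.Algebra" "HOL-Computational_Algebra.Primes"
begin

definition noncyclic_subgroups :: "('a, 'b) monoid_scheme \<Rightarrow> 'a set set" where
  "noncyclic_subgroups G = {H. subgroup H G \<and> \<not> cyclic_group (G\<lparr>carrier := H\<rparr>)}"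

definition delta :: "('a, 'b) monoid_scheme \<Rightarrow> nat" where
  "delta G = card (noncyclic_subgroups G)"

(* Meaningful only for groups of finite exponent, in particular for finite groups. *)
definition group_exponent :: "('a, 'b) monoid_scheme \<Rightarrow> nat" where
  "group_exponent G = (LEAST e. 0 < e \<and> (\<forall>x\<in>carrier G. x [^]\<^bsub>G\<^esub> e = \<one>\<^bsub>G\<^esub>))"

definition elementary_abelian :: "nat \<Rightarrow> ('a, 'b) monoid_scheme \<Rightarrow> bool" where
  "elementary_abelian p G \<longleftrightarrow>
     comm_group G \<and> (\<forall>x\<in>carrier G. x \<noteq> \<one>\<^bsub>G\<^esub> \<longrightarrow> group.ord G x = p)"

(* "M is M_p(1,1,1)".  This group is specified only up to isomorphism, so it is a property
   of M rather than a particular group; is_Mp111_Heisenberg below exhibits an instance for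
   every odd prime p. *)
definition is_Mp111 :: "nat \<Rightarrow> ('a, 'b) monoid_scheme \<Rightarrow> bool" where
  "is_Mp111 p M \<longleftrightarrow>
     group M \<and> \<not> comm_group M \<and> Coset.order M = p ^ 3 \<and> group_exponent M = p"

definition cyclic_power :: "nat \<Rightarrow> nat \<Rightarrow> (nat \<Rightarrow> int) monoid" where
  "cyclic_power p d = product_group {..<d} (\<lambda>_. integer_mod_group p)"

(* Upper unitriangular 3x3 matrices over Z/pZ; (a, b, c) has entries a = m12, b = m23, c = m13. *)
definition Heisenberg_group :: "nat \<Rightarrow> (int \<times> int \<times> int) monoid" where
  "Heisenberg_group p =
     \<lparr>carrier = {0..<int p} \<times> {0..<int p} \<times> {0..<int p},
      monoid.mult = (\<lambda>(a, b, c) (a', b', c').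
        ((a + a') mod int p, (b + b') mod int p, (c + c' + a * b') mod int p)),
      one = (0, 0, 0)\<rparr>"

lemma group_Heisenberg_group:
  assumes "p > 0"
  shows "group (Heisenberg_group p)"
proof (rule groupI)
  fix x y assume "x \<in> carrier (Heisenberg_group p)" "y \<in> carrier (Heisenberg_group p)"
  then show "x \<otimes>\<^bsub>Heisenberg_group p\<^esub> y \<in> carrier (Heisenberg_group p)"
    using assms by (auto simp: Heisenberg_group_def)
next
  show "\<one>\<^bsub>Heisenberg_group p\<^esub> \<in> carrier (Heisenberg_group p)"
    using assms by (auto simp: Heisenberg_group_def)
next
  fix x y z
  show "x \<otimes>\<^bsub>Heisenberg_group p\<^esub> y \<otimes>\<^bsub>Heisenberg_group p\<^esub> z =
        x \<otimes>\<^bsub>Heisenberg_group p\<^esub> (y \<otimes>\<^bsub>Heisenberg_group p\<^esub> z)"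
  proof (cases x; cases y; cases z)
    fix a b c a' b' c' a'' b'' c''
    assume xyz: "x = (a, b, c)" "y = (a', b', c')" "z = (a'', b'', c'')"
    have "((c + c' + a * b') mod int p + c'' + (a + a') mod int p * b'') mod int p
        = (c + c' + a * b' + c'' + (a + a') * b'') mod int p"
      by (intro mod_add_cong mod_mult_cong) (auto simp: mod_simps)
    moreover have "(c + (c' + c'' + a' * b'') mod int p + a * ((b' + b'') mod int p)) mod int p
        = (c + (c' + c'' + a' * b'') + a * (b' + b'')) mod int p"
      by (intro mod_add_cong mod_mult_cong) (auto simp: mod_simps)
    ultimately show ?thesis
      by (simp add: xyz Heisenberg_group_def mod_simps algebra_simps)
  qed
next
  fix x assume "x \<in> carrier (Heisenberg_group p)"
  then show "\<one>\<^bsub>Heisenberg_group p\<^esub> \<otimes>\<^bsub>Heisenberg_group p\<^esub> x = x"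
    by (auto simp: Heisenberg_group_def)
next
  fix x assume "x \<in> carrier (Heisenberg_group p)"
  then obtain a b c where x: "x = (a, b, c)"
    by (metis prod_cases3)
  have "((a * b - c) mod int p + c + (- a) mod int p * b) mod int p
      = (a * b - c + c + (- a) * b) mod int p"
    by (intro mod_add_cong mod_mult_cong) (auto simp: mod_simps)
  then show "\<exists>y\<in>carrier (Heisenberg_group p). y \<otimes>\<^bsub>Heisenberg_group p\<^esub> x = \<one>\<^bsub>Heisenberg_group p\<^esub>"
    using assms unfolding x
    by (intro bexI[of _ "((- a) mod int p, (- b) mod int p, (a * b - c) mod int p)"])
       (auto simp: Heisenberg_group_def mod_simps)
qed

lemma Heisenberg_group_pow:
  assumes "p > 0"
  shows "(a, b, c) [^]\<^bsub>Heisenberg_group p\<^esub> k =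
    ((int k * a) mod int p, (int k * b) mod int p,
     (int k * c + int (k choose 2) * (a * b)) mod int p)"
proof (induction k)
  case 0
  then show ?case by (simp add: Heisenberg_group_def numeral_2_eq_2)
next
  case (Suc k)
  have "((int k * c + int (k choose 2) * (a * b)) mod int p + c + (int k * a) mod int p * b) mod int p
      = (int k * c + int (k choose 2) * (a * b) + c + (int k * a) * b) mod int p"
    by (intro mod_add_cong mod_mult_cong) (auto simp: mod_simps)
  moreover have "Suc k choose 2 = k + (k choose 2)"
    by (simp add: numeral_2_eq_2)
  ultimately show ?case
    unfolding nat_pow_Suc Suc.IH
    by (simp add: Heisenberg_group_def mod_simps algebra_simps)
qed

lemma is_Mp111_Heisenberg:
  assumes "Factorial_Ring.prime p" "odd p"
  shows "is_Mp111 p (Heisenberg_group p)"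
proof -
  let ?M = "Heisenberg_group p"
  have p: "p > 2"
    using assms prime_ge_2_nat by (cases "p = 2") (auto simp: le_less)
  have "order ?M = p ^ 3"
    by (simp add: order_def Heisenberg_group_def card_cartesian_product power3_eq_cube)
  moreover have "\<not> comm_group ?M"
  proof
    assume "comm_group ?M"
    then interpret comm_group ?M .
    have "(1, 0, 0) \<otimes>\<^bsub>?M\<^esub> (0, 1, 0) = (0, 1, 0) \<otimes>\<^bsub>?M\<^esub> (1, 0, 0)"
      using p by (intro m_comm) (auto simp: Heisenberg_group_def)
    then show False
      using p by (simp add: Heisenberg_group_def)
  qed
  moreover have "group_exponent ?M = p"
    unfolding group_exponent_def
  proof (rule Least_equality)
    have "p dvd (p choose 2)"
    proof -
      obtain m where m: "p = 2 * m + 1"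
        using \<open>odd p\<close> by (rule oddE)
      have "p choose 2 = p * m"
        unfolding choose_two m by simp
      then show ?thesis by simp
    qed
    then have "int p dvd int (p choose 2)"
      by simp
    then show "0 < p \<and> (\<forall>x\<in>carrier ?M. x [^]\<^bsub>?M\<^esub> p = \<one>\<^bsub>?M\<^esub>)"
      using p by (auto simp: Heisenberg_group_pow) (simp add: Heisenberg_group_def)
  next
    fix e :: nat assume e: "0 < e \<and> (\<forall>x\<in>carrier ?M. x [^]\<^bsub>?M\<^esub> e = \<one>\<^bsub>?M\<^esub>)"
    have "(1, 0, 0) \<in> carrier ?M"
      using p by (auto simp: Heisenberg_group_def)
    with e have "(1, 0, 0) [^]\<^bsub>?M\<^esub> e = \<one>\<^bsub>?M\<^esub>"
      by blast
    then have "int e mod int p = 0"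
      using p by (simp add: Heisenberg_group_pow) (simp add: Heisenberg_group_def)
    then show "p \<le> e"
      using e by (metis dvd_imp_le mod_0_imp_dvd of_nat_dvd_iff)
  qed
  ultimately show ?thesis
    using group_Heisenberg_group p by (simp add: is_Mp111_def)
qed

end

theory Submission
  imports Defs
begin

text \<open>
  Write \<open>s\<^sub>k\<close> for the number of subgroups of order \<open>p ^ k\<close> and \<open>e\<^sub>k\<close> for the number of those
  that are elementary abelian, and let \<open>D = M \<times>\<times> C\<^sub>p ^ (n - 3)\<close>.  A subgroup of order at most \<open>p\<close>
  of a \<open>p\<close>-group is cyclic, and since \<open>D\<close> has exponent \<open>p\<close>, all its cyclic subgroups have order at most \<open>p\<close>.
  Hence it suffices to bound \<open>s\<^sub>k\<close> of \<open>G\<close> by \<open>s\<^sub>k\<close> of \<open>D\<close> for each \<open>k \<ge> 2\<close>; this is done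
  for all \<open>k\<close> at once.

  Let \<open>Z\<close> be a central subgroup of order \<open>p\<close>.  A subgroup \<open>H\<close> of order \<open>p ^ k\<close> either contains
  \<open>Z\<close>, and is then a subgroup of order \<open>p ^ (k - 1)\<close> of \<open>G / Z\<close>, or it is a complement of \<open>Z\<close> in
  \<open>K = Z H\<close>, where \<open>K / Z\<close> has order \<open>p ^ k\<close>.  The complements of \<open>Z\<close> in \<open>K\<close>, if there are any,
  correspond to the homomorphisms \<open>K / Z \<rightarrow> Z\<close>.  So there are at most \<open>p ^ k\<close> of them, and at most
  \<open>p ^ (k - 1)\<close> if \<open>K / Z\<close> is not elementary abelian, because then some nontrivial \<open>p\<close>-th power or
  commutator lies in every kernel.  This bounds \<open>s\<^sub>k\<close> and \<open>e\<^sub>k\<close> of \<open>G\<close> by the same numbers for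
  \<open>G / Z\<close> (\<open>card_above_rec\<close>, \<open>card_elementary_above_rec\<close>).  The estimates are sharp for \<open>D\<close> when
  \<open>Z\<close> is one of the factors \<open>C\<^sub>p\<close>, which is why the induction over the order closes as long as
  \<open>G / Z\<close> is not elementary abelian.

  If \<open>G / Z\<close> is elementary abelian, only those \<open>K\<close> count that are themselves elementary abelian.
  Regard \<open>G / Z\<close> as a vector space with the commutator form and the power map, both with values
  in \<open>Z\<close>: the \<open>K\<close> in question are the totally isotropic subspaces on which the power map vanishes.
  At least one of the two maps is nonzero.  If it is only the power map, all \<open>K\<close> lie in the
  hyperplane where it vanishes.  If \<open>v\<close> is not in the radical of the form, then \<open>K\<close> lies in the
  hyperplane orthogonal to \<open>v\<close>, or it is spanned by a vector \<open>w\<close> outside that hyperplane and a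
  subspace of the vectors orthogonal to both \<open>v\<close> and \<open>w\<close>.  Counting pairs \<open>(w, K)\<close> shows that a
  form of rank 2, which is the form of \<open>D\<close>, has the most isotropic subspaces
  (\<open>card_isotropic_nonabelian\<close>).

  For the lower bound on \<open>s\<^sub>k\<close> of \<open>D\<close> (\<open>bound_le_card_above\<close>), let \<open>C\<close> be the centre of \<open>D\<close>.  It has
  index \<open>p ^ 2\<close>, and \<open>p + 1\<close> elementary abelian subgroups of index \<open>p\<close> in \<open>D\<close> contain it, any two of
  them meeting in \<open>C\<close>.  It is enough to count the subgroups of \<open>D\<close> that lie in one of these or
  contain the derived subgroup of \<open>D\<close>.

  Quotient groups would change the type of the elements at each step of the induction.  Therefore
  everything is said about subgroups of a fixed group that contain a normal subgroup \<open>N\<close>, which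
  stand for the subgroups of \<open>G / N\<close>.
\<close>

section \<open>Gaussian binomial coefficients and the bounds\<close>

fun gauss_binomial :: "nat \<Rightarrow> nat \<Rightarrow> nat \<Rightarrow> nat" where
  "gauss_binomial q m 0 = 1"
| "gauss_binomial q 0 (Suc k) = 0"
| "gauss_binomial q (Suc m) (Suc k) = gauss_binomial q m k + q ^ Suc k * gauss_binomial q m (Suc k)"

text \<open>
  The other Pascal rule, \<open>[m+1, k+1] = [m, k+1] + q ^ (m - k) [m, k]\<close>, multiplied by \<open>q ^ k\<close> so that
  it holds without assuming \<open>k \<le> m\<close>.  The defining recursion matches the choice of a point in a
  vector space, this one the choice of a hyperplane.
\<close>
lemma gauss_binomial_dual_Pascal:
  "q ^ k * gauss_binomial q (Suc m) (Suc k) = q ^ k * gauss_binomial q m (Suc k) + q ^ m * gauss_binomial q m k"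
proof (induction m arbitrary: k)
  case 0
  show ?case by (cases k) simp_all
next
  case (Suc m)
  show ?case
  proof (cases k)
    case 0
    then show ?thesis using Suc.IH[of 0] by (simp add: algebra_simps)
  next
    case (Suc j)
    have "q ^ k * gauss_binomial q (Suc (Suc m)) (Suc k)
        = q * (q ^ j * gauss_binomial q (Suc m) (Suc j))
          + q ^ Suc k * (q ^ k * gauss_binomial q (Suc m) (Suc k))"
      unfolding gauss_binomial.simps(3)[of q "Suc m" k] Suc by (simp add: algebra_simps)
    also have "\<dots> = q * (q ^ j * gauss_binomial q m (Suc j) + q ^ m * gauss_binomial q m j)
          + q ^ Suc k * (q ^ k * gauss_binomial q m (Suc k) + q ^ m * gauss_binomial q m k)"
      using Suc.IH[of j] Suc.IH[of k] by (simp only:)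
    also have "\<dots> = q ^ k * gauss_binomial q (Suc m) (Suc k) + q ^ Suc m * gauss_binomial q (Suc m) k"
      unfolding Suc by (simp add: algebra_simps)
    finally show ?thesis .
  qed
qed

lemma gauss_binomial_mono_Suc:
  assumes "q > 0"
  shows "gauss_binomial q m k \<le> gauss_binomial q (Suc m) k"
proof (cases k)
  case (Suc j)
  have "q ^ j * gauss_binomial q m (Suc j) \<le> q ^ j * gauss_binomial q (Suc m) (Suc j)"
    unfolding gauss_binomial_dual_Pascal by simp
  then show ?thesis using assms Suc by (simp del: gauss_binomial.simps)
qed simp

text \<open>
  For \<open>r \<ge> 1\<close> this is the number of \<open>k\<close>-dimensional totally isotropic subspaces for an alternating
  form of rank 2 on a space of dimension \<open>r + 1\<close> over the field of \<open>q\<close> elements: the radical has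
  dimension \<open>r - 1\<close>, each isotropic subspace lies in one of the \<open>q + 1\<close> hyperplanes containing it,
  and two of these hyperplanes meet in the radical.  For \<open>r = 0\<close> the truncated subtraction leaves
  only the trivial subspace.
\<close>
definition isotropic_bound :: "nat \<Rightarrow> nat \<Rightarrow> nat \<Rightarrow> nat" where
  "isotropic_bound q r k =
     gauss_binomial q r k + q * (gauss_binomial q r k - gauss_binomial q (r - 1) k)"

lemma isotropic_bound_zero [simp]: "isotropic_bound q r 0 = 1"
  by (simp add: isotropic_bound_def)

text \<open>
  For \<open>r \<ge> 1\<close> both sides agree, as the bound is then a linear combination of Gaussian binomials
  whose coefficients do not depend on \<open>r\<close>.  Only in the step from \<open>r = 0\<close> can the inequality be strict.
\<close>
lemma isotropic_bound_Suc:
  assumes "q > 0"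
  shows "isotropic_bound q r k + q ^ Suc k * isotropic_bound q r (Suc k)
    \<le> isotropic_bound q (Suc r) (Suc k)"
proof (cases r)
  case 0
  then show ?thesis by (cases k) (simp_all add: isotropic_bound_def)
next
  case (Suc s)
  define a b c d where "a = gauss_binomial q r k" and "b = gauss_binomial q s k"
    and "c = gauss_binomial q r (Suc k)" and "d = gauss_binomial q s (Suc k)"
  have le: "b \<le> a" "d \<le> c"
    using gauss_binomial_mono_Suc[OF assms, of s] by (simp_all add: a_def b_def c_def d_def Suc del: gauss_binomial.simps)
  then obtain u v where uv: "a = b + u" "c = d + v"
    by (metis le_iff_add)
  have "isotropic_bound q (Suc r) (Suc k)
      = (a + q ^ Suc k * c) + q * ((a + q ^ Suc k * c) - (b + q ^ Suc k * d))"
    by (simp add: isotropic_bound_def a_def b_def c_def d_def Suc)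
  also have "(a + q ^ Suc k * c) - (b + q ^ Suc k * d) = u + q ^ Suc k * v"
    by (simp add: uv algebra_simps)
  also have "(a + q ^ Suc k * c) + q * (u + q ^ Suc k * v) = (a + q * u) + q ^ Suc k * (c + q * v)"
    by (simp add: algebra_simps)
  also have "a + q * u = isotropic_bound q r k"
    unfolding isotropic_bound_def Suc diff_Suc_1 by (simp add: a_def[symmetric] b_def[symmetric] flip: Suc) (simp add: uv)
  also have "c + q * v = isotropic_bound q r (Suc k)"
    unfolding isotropic_bound_def Suc diff_Suc_1 by (simp add: c_def[symmetric] d_def[symmetric] flip: Suc del: gauss_binomial.simps) (simp add: uv)
  finally show ?thesis by simp
qed

text \<open>
  For \<open>r \<ge> 1\<close> and an odd prime \<open>q\<close>, the number of subgroups of order \<open>q ^ k\<close> in \<open>M\<^sub>q(1,1,1) \<times> C\<^sub>q ^ (r - 1)\<close>, a group of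
  order \<open>q ^ (r + 2)\<close>: those containing the derived subgroup, and \<open>q ^ k\<close> complements of it
  for each isotropic subspace of the quotient.
\<close>
fun subgroups_bound :: "nat \<Rightarrow> nat \<Rightarrow> nat \<Rightarrow> nat" where
  "subgroups_bound q r 0 = 1"
| "subgroups_bound q r (Suc k) = gauss_binomial q (Suc r) k + q ^ Suc k * isotropic_bound q r (Suc k)"

text \<open>
  The number of elementary abelian ones among the subgroups counted by \<open>subgroups_bound\<close>.
\<close>
fun elementary_bound :: "nat \<Rightarrow> nat \<Rightarrow> nat \<Rightarrow> nat" where
  "elementary_bound q r 0 = 1"
| "elementary_bound q r (Suc k) = isotropic_bound q r k + q ^ Suc k * isotropic_bound q r (Suc k)"

lemma elementary_bound_le_isotropic:
  "q > 0 \<Longrightarrow> elementary_bound q r k \<le> isotropic_bound q (Suc r) k"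
  by (cases k) (use isotropic_bound_Suc in auto)

lemma elementary_bound_Suc:
  assumes "q > 0"
  shows "elementary_bound q r k + q ^ Suc k * elementary_bound q r (Suc k) \<le> elementary_bound q (Suc r) (Suc k)"
  unfolding elementary_bound.simps(2)[of q "Suc r"]
  by (intro add_mono mult_le_mono order_refl elementary_bound_le_isotropic assms)

text \<open>
  The inductive step of the main count.  The factor of \<open>e\<close> is nonnegative, so that upper bounds for
  \<open>e\<close> and \<open>s\<close> may be inserted; after that the claim reduces to the recursions of the Gaussian
  binomials and of \<open>isotropic_bound\<close>.
\<close>
lemma subgroups_bound_Suc:
  assumes "q > 0" "e \<le> elementary_bound q r (Suc k)" "s \<le> subgroups_bound q r (Suc k)"
  shows "subgroups_bound q r k + (q ^ Suc k - q ^ k) * e + q ^ k * s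
    \<le> subgroups_bound q (Suc r) (Suc k)"
proof -
  let ?I = "isotropic_bound q r"
  obtain c where c: "q ^ Suc k = q ^ k + c"
    using assms(1) by (metis le_iff_add power_increasing_iff le_SucI order_refl power_Suc2 mult.commute nat_mult_le_cancel_disj mult_le_mono1 Suc_leI One_nat_def nat_mult_1)
  have A: "subgroups_bound q r k + q ^ k * gauss_binomial q (Suc r) k \<le> gauss_binomial q (Suc (Suc r)) k + q ^ k * ?I k"
    by (cases k) (simp_all add: algebra_simps)
  have "subgroups_bound q r k + c * e + q ^ k * s
     \<le> subgroups_bound q r k + c * elementary_bound q r (Suc k) + q ^ k * subgroups_bound q r (Suc k)"
    by (intro add_mono mult_le_mono order_refl assms)
  also have "\<dots> = subgroups_bound q r k + q ^ k * gauss_binomial q (Suc r) k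
       + c * ?I k + (q ^ k + c) * (q ^ Suc k * ?I (Suc k))"
    by (simp only: elementary_bound.simps subgroups_bound.simps distrib_left distrib_right ac_simps)
  also have "\<dots> \<le> gauss_binomial q (Suc (Suc r)) k + q ^ k * ?I k + c * ?I k + (q ^ k + c) * (q ^ Suc k * ?I (Suc k))"
    using A by linarith
  also have "\<dots> = gauss_binomial q (Suc (Suc r)) k + q ^ Suc k * (?I k + q ^ Suc k * ?I (Suc k))"
    by (simp only: c distrib_left distrib_right ac_simps)
  also have "\<dots> \<le> gauss_binomial q (Suc (Suc r)) k + q ^ Suc k * isotropic_bound q (Suc r) (Suc k)"
    by (intro add_mono mult_le_mono order_refl isotropic_bound_Suc assms)
  finally show ?thesis
    unfolding subgroups_bound.simps(2)[of q "Suc r"] by (simp only: c add_diff_cancel_left')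
qed

section \<open>Finite p-groups and central elements modulo a normal subgroup\<close>

text \<open>
  The subgroups of order \<open>p ^ k\<close> of \<open>G / N\<close>, represented by their preimages in \<open>G\<close>.
\<close>
definition subgroups_above :: "('a, 'b) monoid_scheme \<Rightarrow> nat \<Rightarrow> 'a set \<Rightarrow> nat \<Rightarrow> 'a set set" where
  "subgroups_above G p N k = {H. subgroup H G \<and> N \<subseteq> H \<and> card H = p ^ k * card N}"

definition commutator :: "('a, 'b) monoid_scheme \<Rightarrow> 'a \<Rightarrow> 'a \<Rightarrow> 'a" where
  "commutator G x y = x \<otimes>\<^bsub>G\<^esub> y \<otimes>\<^bsub>G\<^esub> inv\<^bsub>G\<^esub> x \<otimes>\<^bsub>G\<^esub> inv\<^bsub>G\<^esub> y"

text \<open>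
  For a normal subgroup \<open>N\<close> and a subgroup \<open>H\<close>, this says that the image of \<open>H\<close> in \<open>G / N\<close> is
  elementary abelian.
\<close>
definition elementary_abelian_mod :: "('a, 'b) monoid_scheme \<Rightarrow> nat \<Rightarrow> 'a set \<Rightarrow> 'a set \<Rightarrow> bool" where
  "elementary_abelian_mod G p N H \<longleftrightarrow>
     (\<forall>x\<in>H. x [^]\<^bsub>G\<^esub> p \<in> N) \<and> (\<forall>x\<in>H. \<forall>y\<in>H. commutator G x y \<in> N)"

text \<open>
  Says that \<open>Z / N\<close> is a central subgroup of order \<open>p\<close> of \<open>G / N\<close>.
\<close>
definition central_step :: "('a, 'b) monoid_scheme \<Rightarrow> nat \<Rightarrow> 'a set \<Rightarrow> 'a set \<Rightarrow> bool" where
  "central_step G p N Z \<longleftrightarrow> N \<lhd> G \<and> Z \<lhd> G \<and> N \<subseteq> Z \<and> card Z = p * card N \<and>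
     (\<forall>z\<in>Z. z [^]\<^bsub>G\<^esub> p \<in> N) \<and> (\<forall>z\<in>Z. \<forall>g\<in>carrier G. commutator G z g \<in> N)"

lemma (in group) commutator_mem_iff:
  assumes "N \<lhd> G" "x \<in> carrier G" "y \<in> carrier G"
  shows "commutator G x y \<in> N \<longleftrightarrow> N #> (x \<otimes> y) = N #> (y \<otimes> x)"
proof -
  interpret N: normal N G by fact
  have "commutator G x y = (x \<otimes> y) \<otimes> inv (y \<otimes> x)"
    using assms by (simp add: commutator_def inv_mult_group m_assoc)
  then show ?thesis
    using assms N.rcos_module[OF is_group, of "y \<otimes> x" "x \<otimes> y"]
    by (metis N.is_subgroup m_closed repr_independence repr_independenceD)
qed

locale finite_p_group = group G for G (structure) +
  fixes p n :: nat
  assumes prime_p: "Factorial_Ring.prime p" and order_G: "order G = p ^ n"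
begin

lemma p_gt_1: "p > 1" and p_pos: "p > 0"
  using prime_p prime_gt_1_nat by (auto simp: prime_gt_0_nat)

lemma fin_carrier: "finite (carrier G)"
  using order_G p_pos by (metis order_gt_0_iff_finite zero_less_power)

lemma fin_subgroup: "subgroup H G \<Longrightarrow> finite H"
  using fin_carrier finite_subset subgroup.subset by blast

lemma fin_subgroups: "finite {H. subgroup H G}"
  by (rule finite_subset[OF _ finite_Pow_iff[THEN iffD2, OF fin_carrier]])
     (auto dest: subgroup.subset)

lemma fin_above: "finite (subgroups_above G p N k)"
  by (rule finite_subset[OF _ fin_subgroups]) (auto simp: subgroups_above_def)

lemma card_subgroup_pos: "subgroup H G \<Longrightarrow> card H > 0"
  using fin_subgroup subgroup.one_closed by (fastforce simp: card_gt_0_iff)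

lemma card_subgroup: "subgroup H G \<Longrightarrow> \<exists>i\<le>n. card H = p ^ i"
  using lagrange[of H] order_G divides_primepow_nat[OF prime_p]
  by (metis dvd_triv_right)

text \<open>
  Most index computations below go through this inequality: as soon as \<open>card B \<le> p * card A\<close> is
  known for a proper subgroup \<open>A\<close> of \<open>B\<close>, the index is exactly \<open>p\<close>.
\<close>
lemma card_proper_subgroup:
  assumes "subgroup A G" "subgroup B G" "A \<subset> B"
  shows "p * card A \<le> card B"
proof -
  obtain i j where ij: "card A = p ^ i" "card B = p ^ j"
    using card_subgroup assms by blast
  have "card A < card B"
    using assms fin_subgroup psubset_card_mono by blast
  then have "i < j"
    using ij p_gt_1 by (simp add: power_strict_increasing_iff)
  then have "p ^ Suc i \<le> p ^ j"
    using p_pos by (intro power_increasing) auto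
  then show ?thesis using ij by simp
qed

lemma finite_p_group_subgroup:
  assumes "subgroup W G"
  shows "\<exists>m. finite_p_group (G\<lparr>carrier := W\<rparr>) p m"
proof -
  obtain i where i: "card W = p ^ i" using card_subgroup[OF assms] by blast
  have "group (G\<lparr>carrier := W\<rparr>)"
    using assms subgroup_imp_group by blast
  then show ?thesis
    using i prime_p
    by (intro exI[of _ i]) (simp add: finite_p_group_def finite_p_group_axioms_def order_def)
qed

lemma finite_closed_imp_subgroup:
  assumes "H \<subseteq> carrier G" "\<one> \<in> H" "\<And>x y. x \<in> H \<Longrightarrow> y \<in> H \<Longrightarrow> x \<otimes> y \<in> H"
  shows "subgroup H G"
proof (rule subgroupI)
  fix a assume a: "a \<in> H"
  have "a [^] k \<in> H" for k :: nat
    by (induction k) (use assms a in auto)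
  moreover have "inv a = a [^] (order G - 1)"
  proof -
    have "a [^] (order G - 1) \<otimes> a = a [^] Suc (order G - 1)" by simp
    also have "\<dots> = \<one>"
      using a assms(1) pow_order_eq_1 order_gt_0_iff_finite fin_carrier
      by (metis Suc_diff_1 subsetD)
    finally show ?thesis
      using a assms(1) by (metis inv_equality nat_pow_closed subsetD)
  qed
  ultimately show "inv a \<in> H" by simp
qed (use assms in auto)

text \<open>
  If \<open>x\<close> normalises \<open>N\<close> and \<open>x [^] p\<close> lies in \<open>N\<close>, the products \<open>y \<otimes> x [^] i\<close> with \<open>y\<close> in \<open>N\<close> and \<open>i < p\<close>
  are closed under multiplication, and they form the subgroup generated by \<open>N\<close> and \<open>x\<close>.
\<close>
lemma adjoin_element:
  assumes N: "subgroup N G" and x: "x \<in> carrier G" "x \<notin> N"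
    and conj: "\<And>y. y \<in> N \<Longrightarrow> x \<otimes> y \<otimes> inv x \<in> N" and pow: "x [^] p \<in> N"
  obtains H where "subgroup H G" "N \<subseteq> H" "x \<in> H" "card H = p * card N"
    "\<And>K. subgroup K G \<Longrightarrow> N \<subseteq> K \<Longrightarrow> x \<in> K \<Longrightarrow> H \<subseteq> K"
    "\<And>h. h \<in> H \<Longrightarrow> \<exists>y\<in>N. \<exists>i::nat. h = y \<otimes> x [^] i"
proof -
  define H where "H = (\<lambda>(y, i). y \<otimes> x [^] i) ` (N \<times> {..<p})"
  note Nc = subgroup.mem_carrier[OF N]
  have mod_p: "y \<otimes> x [^] i \<in> H" if "y \<in> N" for y and i :: nat
  proof -
    have "x [^] i = (x [^] p) [^] (i div p) \<otimes> x [^] (i mod p)"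
      using x by (simp add: nat_pow_pow nat_pow_mult)
    then have "y \<otimes> x [^] i = (y \<otimes> (x [^] p) [^] (i div p)) \<otimes> x [^] (i mod p)"
      using that x Nc by (simp add: m_assoc)
    moreover have "(x [^] p) [^] k \<in> N" for k :: nat
      by (induction k) (use pow N in \<open>auto simp: subgroup.one_closed subgroup.m_closed\<close>)
    ultimately show ?thesis
      unfolding H_def using that N p_pos
      by (intro image_eqI[where x = "(y \<otimes> (x [^] p) [^] (i div p), i mod p)"]) (auto simp: subgroup.m_closed)
  qed
  have conj': "x [^] i \<otimes> y \<otimes> inv (x [^] i) \<in> N" if "y \<in> N" for y and i :: nat
  proof (induction i)
    case 0
    then show ?case using that Nc by simp
  next
    case (Suc i)
    have "x [^] Suc i \<otimes> y \<otimes> inv (x [^] Suc i) = x \<otimes> (x [^] i \<otimes> y \<otimes> inv (x [^] i)) \<otimes> inv x"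
      unfolding nat_pow_Suc2[OF x(1)] using x that Nc by (simp add: inv_mult_group m_assoc)
    then show ?case using conj[OF Suc] by simp
  qed
  have sub: "subgroup H G"
  proof (rule finite_closed_imp_subgroup)
    show "H \<subseteq> carrier G" using Nc x by (auto simp: H_def)
    show "\<one> \<in> H" using mod_p[of \<one> 0] subgroup.one_closed[OF N] by simp
    fix a b assume "a \<in> H" "b \<in> H"
    then obtain y i z j where e: "a = y \<otimes> x [^] (i::nat)" "b = z \<otimes> x [^] (j::nat)" "y \<in> N" "z \<in> N"
      by (auto simp: H_def)
    have "a \<otimes> b = (y \<otimes> (x [^] i \<otimes> z \<otimes> inv (x [^] i))) \<otimes> x [^] (i + j)"
      using e x Nc by (simp add: m_assoc inv_solve_left flip: nat_pow_mult)
    then show "a \<otimes> b \<in> H"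
      using mod_p conj' e N by (simp add: subgroup.m_closed)
  qed
  have NH: "N \<subseteq> H" using mod_p[of _ 0] Nc by fastforce
  have xH: "x \<in> H" using mod_p[of \<one> 1] x subgroup.one_closed[OF N] by simp
  have "card H \<le> card (N \<times> {..<p})"
    unfolding H_def by (intro card_image_le) (use fin_subgroup N in auto)
  then have "card H \<le> p * card N" by (simp add: card_cartesian_product mult.commute)
  moreover have "p * card N \<le> card H"
    using card_proper_subgroup[OF N sub] NH xH x by blast
  moreover have "H \<subseteq> K" if "subgroup K G" "N \<subseteq> K" "x \<in> K" for K
  proof -
    have "x [^] i \<in> K" for i :: nat
      by (induction i) (use that in \<open>auto simp: subgroup.one_closed subgroup.m_closed\<close>)
    then show ?thesis using that by (auto simp: H_def subgroup.m_closed)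
  qed
  moreover have "\<exists>y\<in>N. \<exists>i::nat. h = y \<otimes> x [^] i" if "h \<in> H" for h
    using that by (auto simp: H_def)
  ultimately show ?thesis using that[of H] sub NH xH by (meson le_antisym)
qed

text \<open>
  The class equation: if \<open>\<one>\<close> were the only central element, all other conjugacy classes would have a
  size divisible by \<open>p\<close>, and \<open>p\<close> would divide 1.  A suitable power of a nontrivial central
  element has order \<open>p\<close>.
\<close>
lemma central_element_of_order_p:
  assumes "n > 0"
  shows "\<exists>z\<in>carrier G. z \<noteq> \<one> \<and> z [^] p = \<one> \<and> (\<forall>g\<in>carrier G. z \<otimes> g = g \<otimes> z)"
proof -
  define C where "C = {z \<in> carrier G. \<forall>g\<in>carrier G. z \<otimes> g = g \<otimes> z}"
  let ?f = "\<lambda>g. \<lambda>h\<in>carrier G. g \<otimes> h \<otimes> inv g"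
  interpret act: group_action G "carrier G" ?f by (rule action_by_conjugation)
  let ?O = "orbits G (carrier G) ?f"
  have "\<exists>z\<in>C. z \<noteq> \<one>"
  proof (rule ccontr)
    assume "\<not> ?thesis"
    then have C1: "z = \<one>" if "z \<in> C" for z using that by auto
    have orb1: "orbit G ?f \<one> = {\<one>}" by (auto simp: orbit_def intro!: exI[of _ \<one>])
    have dvd: "p dvd card B" if B: "B \<in> ?O - {{\<one>}}" for B
    proof -
      obtain x where x: "x \<in> carrier G" "B = orbit G ?f x" using B by (auto simp: orbits_def)
      have "x \<noteq> \<one>" using x B orb1 by auto
      then have "x \<notin> C" using C1 by blast
      then obtain g where g: "g \<in> carrier G" "x \<otimes> g \<noteq> g \<otimes> x" using x by (auto simp: C_def)
      have "g \<otimes> x \<otimes> inv g \<noteq> x"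
      proof
        assume "g \<otimes> x \<otimes> inv g = x"
        then have "g \<otimes> x \<otimes> inv g \<otimes> g = x \<otimes> g" by simp
        then show False using g x by (simp add: m_assoc)
      qed
      moreover have "x \<in> B" using x act.orbit_refl by blast
      moreover have "g \<otimes> x \<otimes> inv g \<in> B"
        unfolding x(2) orbit_def using x(1) g(1) by (auto intro!: exI[of _ g])
      moreover have "card B * card (stabilizer G ?f x) = p ^ n"
        using act.orbit_stabilizer_theorem[OF x(1)] by (simp only: x(2) order_G)
      then have "card B dvd p ^ n" by (rule dvdI[OF sym])
      then obtain i where "card B = p ^ i" using divides_primepow_nat[OF prime_p] by blast
      ultimately show ?thesis
        by (cases i) (auto simp: card_1_singleton_iff)
    qed
    have O1: "{\<one>} \<in> ?O" using orb1 by (auto simp: orbits_def)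
    have fO: "finite ?O" using fin_carrier by (simp add: orbits_def)
    have "p ^ n = (\<Sum>B\<in>?O. card B)"
      using act.disjoint_sum[OF fin_carrier, of "\<lambda>_. 1::nat"] order_G by (simp add: order_def)
    also have "\<dots> = 1 + (\<Sum>B\<in>?O - {{\<one>}}. card B)"
      using sum.remove[OF fO O1, of card] by simp
    finally have "p ^ n = 1 + (\<Sum>B\<in>?O - {{\<one>}}. card B)" .
    moreover have "p dvd (\<Sum>B\<in>?O - {{\<one>}}. card B)" using dvd by (rule dvd_sum)
    moreover have "p dvd p ^ n" using assms by simp
    ultimately have "p dvd 1"
      using dvd_add_left_iff[of p "\<Sum>B\<in>?O - {{\<one>}}. card B" 1] by simp
    then show False using p_gt_1 by simp
  qed
  then obtain c where c: "c \<in> carrier G" "c \<noteq> \<one>" "\<And>g. g \<in> carrier G \<Longrightarrow> c \<otimes> g = g \<otimes> c"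
    by (auto simp: C_def)
  \<comment> \<open>the power of \<open>c\<close> just before the trivial one in the sequence \<open>c, c [^] p, c [^] p ^ 2, \<dots>\<close>\<close>
  define i where "i = (LEAST i. c [^] (p ^ i) = \<one>)"
  have "c [^] (p ^ n) = \<one>" using pow_order_eq_1[OF c(1)] order_G by simp
  then have i: "c [^] (p ^ i) = \<one>" unfolding i_def by (rule LeastI)
  then have "i \<noteq> 0" using c by (cases i) auto
  then obtain j where j: "i = Suc j" using not0_implies_Suc by blast
  then have "c [^] (p ^ j) \<noteq> \<one>" using not_less_Least[of j "\<lambda>i. c [^] (p ^ i) = \<one>"] i_def by auto
  moreover have "(c [^] (p ^ j)) [^] p = \<one>"
    using i j c by (simp add: nat_pow_pow mult.commute)
  moreover have "c [^] (p ^ j) \<otimes> g = g \<otimes> c [^] (p ^ j)" if "g \<in> carrier G" for g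
    using group_commutes_pow[OF c(3)[OF that] c(1) that] .
  ultimately show ?thesis using c by blast
qed

end

section \<open>Counting complements of a central step\<close>

text \<open>
  The fibre of the multiplication map \<open>Z \<times> H \<rightarrow> Z <#> H\<close> over \<open>z \<otimes> h\<close> consists of the pairs
  \<open>(z \<otimes> i, inv i \<otimes> h)\<close> with \<open>i\<close> in \<open>Z \<inter> H\<close>.
\<close>
lemma (in group) card_set_mult:
  assumes Z: "subgroup Z G" "finite Z" and H: "subgroup H G" "finite H"
  shows "card (Z <#> H) * card (Z \<inter> H) = card Z * card H"
proof -
  note Zc = subgroup.mem_carrier[OF Z(1)] and Hc = subgroup.mem_carrier[OF H(1)]
  let ?f = "\<lambda>(z, h). z \<otimes> h"
  have im: "Z <#> H = ?f ` (Z \<times> H)" by (auto simp: set_mult_def)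
  have fibre: "card {u \<in> Z \<times> H. ?f u = x} = card (Z \<inter> H)" if "x \<in> Z <#> H" for x
  proof -
    obtain z h where zh: "z \<in> Z" "h \<in> H" "x = z \<otimes> h" using \<open>x \<in> _\<close> by (auto simp: set_mult_def)
    have zc: "z \<in> carrier G" and hc: "h \<in> carrier G" using zh Zc Hc by auto
    have "bij_betw (\<lambda>i. (z \<otimes> i, inv i \<otimes> h)) (Z \<inter> H) {u \<in> Z \<times> H. ?f u = x}"
    proof (rule bij_betw_imageI)
      show "inj_on (\<lambda>i. (z \<otimes> i, inv i \<otimes> h)) (Z \<inter> H)"
        using zc Zc by (auto intro!: inj_onI)
      show "(\<lambda>i. (z \<otimes> i, inv i \<otimes> h)) ` (Z \<inter> H) = {u \<in> Z \<times> H. ?f u = x}"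
      proof (intro Set.set_eqI iffI)
        fix u assume "u \<in> (\<lambda>i. (z \<otimes> i, inv i \<otimes> h)) ` (Z \<inter> H)"
        then obtain i where i: "i \<in> Z" "i \<in> H" "u = (z \<otimes> i, inv i \<otimes> h)" by auto
        have "z \<otimes> i \<otimes> (inv i \<otimes> h) = z \<otimes> (i \<otimes> inv i) \<otimes> h"
          using zc hc Zc[OF i(1)] by (simp only: m_assoc m_closed inv_closed)
        then have "z \<otimes> i \<otimes> (inv i \<otimes> h) = x" using zh(3) zc hc Zc[OF i(1)] by simp
        then show "u \<in> {u \<in> Z \<times> H. ?f u = x}"
          using i zh Z H by (simp add: subgroup.m_closed subgroup.m_inv_closed)
      next
        fix u assume "u \<in> {u \<in> Z \<times> H. ?f u = x}"
        then obtain a b where ab: "u = (a, b)" "a \<in> Z" "b \<in> H" "a \<otimes> b = z \<otimes> h"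
          using zh(3) by auto
        have ac: "a \<in> carrier G" and bc: "b \<in> carrier G" using ab Zc Hc by auto
        have a: "a = z \<otimes> h \<otimes> inv b" using ab(4) ac bc zc hc by (simp add: inv_solve_right)
        have "inv z \<otimes> a = h \<otimes> inv b"
          unfolding a using zc hc bc by (simp add: m_assoc[symmetric])
        moreover have "inv z \<otimes> a \<in> Z" "h \<otimes> inv b \<in> H"
          using ab zh Z H by (simp_all add: subgroup.m_closed subgroup.m_inv_closed)
        ultimately have i: "inv z \<otimes> a \<in> Z \<inter> H" by simp
        have "z \<otimes> (inv z \<otimes> a) = a" using zc ac by (simp add: m_assoc[symmetric])
        moreover have "inv (inv z \<otimes> a) \<otimes> h = b"
        proof -
          have "inv (inv z \<otimes> a) \<otimes> h = inv a \<otimes> (z \<otimes> h)"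
            using zc ac hc by (simp add: inv_mult_group m_assoc)
          also have "\<dots> = b" unfolding ab(4)[symmetric] using ac bc by (simp add: m_assoc[symmetric])
          finally show ?thesis .
        qed
        ultimately show "u \<in> (\<lambda>i. (z \<otimes> i, inv i \<otimes> h)) ` (Z \<inter> H)"
          using i ab(1) by (intro image_eqI[OF _ i]) simp
      qed
    qed
    then show ?thesis by (rule bij_betw_same_card[symmetric])
  qed
  have "card Z * card H = (\<Sum>u\<in>Z \<times> H. 1::nat)"
    by (simp add: card_cartesian_product)
  also have "\<dots> = (\<Sum>x\<in>Z <#> H. \<Sum>u\<in>{u \<in> Z \<times> H. ?f u = x}. 1)"
    unfolding im using Z H by (intro sum.image_gen) auto
  also have "\<dots> = card (Z <#> H) * card (Z \<inter> H)"
    using fibre by simp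
  finally show ?thesis by simp
qed

text \<open>
  Computations modulo \<open>N\<close> are transported through this homomorphism.  The group \<open>Q\<close> is \<open>G Mod N\<close>;
  hiding that keeps the simplifier from unfolding its operations into operations on cosets.
\<close>
lemma (in group) quotient_hom:
  assumes N: "N \<lhd> G"
  obtains Q :: "'a set monoid" and f where "group_hom G Q f" "f ` carrier G = carrier Q"
    "\<And>x. x \<in> carrier G \<Longrightarrow> f x = \<one>\<^bsub>Q\<^esub> \<longleftrightarrow> x \<in> N" "order Q * card N = order G"
proof -
  interpret N: normal N G by fact
  show ?thesis
  proof (rule that[of "G Mod N" "\<lambda>a. N #> a"])
    show "group_hom G (G Mod N) (\<lambda>a. N #> a)"
      by (intro group_hom.intro group_hom_axioms.intro is_group N.factorgroup_is_group N.r_coset_hom_Mod)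
    show "(\<lambda>a. N #> a) ` carrier G = carrier (G Mod N)"
      by (simp add: carrier_FactGroup)
    show "N #> x = \<one>\<^bsub>G Mod N\<^esub> \<longleftrightarrow> x \<in> N" if "x \<in> carrier G" for x
      using coset_join1[OF _ that N.is_subgroup] coset_join2[OF that N.is_subgroup]
      unfolding one_FactGroup by blast
    show "order (G Mod N) * card N = order G"
      using lagrange[OF N.is_subgroup] by (simp add: FactGroup_def order_def)
  qed
qed

lemma (in group) commutator_closed [simp, intro]:
  "x \<in> carrier G \<Longrightarrow> y \<in> carrier G \<Longrightarrow> commutator G x y \<in> carrier G"
  by (simp add: commutator_def)

lemma (in group_hom) commutator_trivial_iff:
  assumes "x \<in> carrier G" "y \<in> carrier G"
  shows "h (commutator G x y) = \<one>\<^bsub>H\<^esub> \<longleftrightarrow> h x \<otimes>\<^bsub>H\<^esub> h y = h y \<otimes>\<^bsub>H\<^esub> h x"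
proof -
  have "h (commutator G x y) = (h x \<otimes>\<^bsub>H\<^esub> h y) \<otimes>\<^bsub>H\<^esub> inv\<^bsub>H\<^esub> (h y \<otimes>\<^bsub>H\<^esub> h x)"
    using assms by (simp add: commutator_def H.inv_mult_group H.m_assoc)
  also have "\<dots> = \<one>\<^bsub>H\<^esub> \<longleftrightarrow> h x \<otimes>\<^bsub>H\<^esub> h y = h y \<otimes>\<^bsub>H\<^esub> h x"
    using assms by (metis H.inv_equality H.inv_inv H.m_closed H.r_inv H.inv_closed hom_closed)
  finally show ?thesis .
qed

text \<open>
  A subgroup containing the kernel is a union of fibres.
\<close>
lemma (in group_hom) same_image_mem_iff:
  assumes "subgroup A G" "\<And>x. x \<in> carrier G \<Longrightarrow> h x = \<one>\<^bsub>H\<^esub> \<Longrightarrow> x \<in> A"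
    and "x \<in> carrier G" "y \<in> carrier G" "h x = h y"
  shows "x \<in> A \<longleftrightarrow> y \<in> A"
proof -
  have *: "u \<in> A" if "v \<in> A" "u \<in> carrier G" "h u = h v" for u v
  proof -
    have v: "v \<in> carrier G" using subgroup.mem_carrier[OF assms(1) that(1)] .
    have "h (u \<otimes> inv v) = \<one>\<^bsub>H\<^esub>" using that v by simp
    then have "u \<otimes> inv v \<in> A" using assms(2) that v by simp
    then have "u \<otimes> inv v \<otimes> v \<in> A" using that assms(1) by (simp add: subgroup.m_closed)
    then show ?thesis using that v by (simp add: G.m_assoc)
  qed
  show ?thesis
    using *[OF _ assms(4) assms(5)[symmetric]] *[OF _ assms(3) assms(5)] by blast
qed

context finite_p_group
begin

lemma central_step_exists:
  assumes N: "N \<lhd> G" and ord: "order G = p ^ Suc m * card N"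
  shows "\<exists>Z. central_step G p N Z"
proof -
  have Ns: "subgroup N G" using N normal_imp_subgroup by blast
  obtain Q :: "'a set monoid" and f where Q: "group_hom G Q f" "f ` carrier G = carrier Q"
    and ker: "\<And>x. x \<in> carrier G \<Longrightarrow> f x = \<one>\<^bsub>Q\<^esub> \<longleftrightarrow> x \<in> N" and oQ: "order Q * card N = order G"
    using quotient_hom[OF N] by metis
  interpret f: group_hom G Q f by fact
  have "order Q = p ^ Suc m" using oQ ord card_subgroup_pos[OF Ns] by simp
  then interpret Q: finite_p_group Q p "Suc m"
    using prime_p by unfold_locales
  obtain z where z: "z \<in> carrier Q" "z \<noteq> \<one>\<^bsub>Q\<^esub>" "z [^]\<^bsub>Q\<^esub> p = \<one>\<^bsub>Q\<^esub>"
    "\<And>g. g \<in> carrier Q \<Longrightarrow> z \<otimes>\<^bsub>Q\<^esub> g = g \<otimes>\<^bsub>Q\<^esub> z"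
    using Q.central_element_of_order_p by auto
  then obtain c where c: "c \<in> carrier G" "f c = z" using Q(2) by (metis imageE)
  have "c \<notin> N" using c z ker by blast
  moreover have "c [^] p \<in> N" using c z ker by (simp flip: ker add: f.hom_nat_pow)
  moreover have "c \<otimes> y \<otimes> inv c \<in> N" if "y \<in> N" for y
    using N c that normal.inv_op_closed2 by metis
  ultimately obtain Z where Z: "subgroup Z G" "N \<subseteq> Z" "c \<in> Z" "card Z = p * card N"
    "\<And>h. h \<in> Z \<Longrightarrow> \<exists>y\<in>N. \<exists>i::nat. h = y \<otimes> c [^] i"
    using adjoin_element[OF Ns c(1)] by metis
  note Nc = subgroup.mem_carrier[OF Ns] and Zc = subgroup.mem_carrier[OF Z(1)]
  have fZ: "\<exists>i::nat. f h = z [^]\<^bsub>Q\<^esub> i" if h: "h \<in> Z" for h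
  proof -
    obtain y i where "y \<in> N" "h = y \<otimes> c [^] (i::nat)" using Z(5)[OF h] by blast
    then have "f h = z [^]\<^bsub>Q\<^esub> i" using Nc ker[of y] c z(1) by (simp add: f.hom_nat_pow)
    then show ?thesis by blast
  qed
  have pw: "h [^] p \<in> N" if h: "h \<in> Z" for h
  proof -
    obtain i where i: "f h = z [^]\<^bsub>Q\<^esub> (i::nat)" using fZ[OF h] by blast
    have "f (h [^] p) = (z [^]\<^bsub>Q\<^esub> p) [^]\<^bsub>Q\<^esub> i"
      using i z(1) Zc[OF h] by (simp add: f.hom_nat_pow f.H.nat_pow_pow mult.commute)
    then show ?thesis using z ker Zc[OF h] by simp
  qed
  have comm: "commutator G h g \<in> N" if h: "h \<in> Z" and g: "g \<in> carrier G" for h g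
  proof -
    obtain i where i: "f h = z [^]\<^bsub>Q\<^esub> (i::nat)" using fZ[OF h] by blast
    have "f h \<otimes>\<^bsub>Q\<^esub> f g = f g \<otimes>\<^bsub>Q\<^esub> f h"
      unfolding i using z g by (intro f.H.group_commutes_pow) auto
    then have "f (commutator G h g) = \<one>\<^bsub>Q\<^esub>"
      using f.commutator_trivial_iff Zc[OF h] g by blast
    then show ?thesis using ker Zc[OF h] g by blast
  qed
  have "Z \<lhd> G"
  proof (rule normal_invI[OF Z(1)])
    fix g h assume g: "g \<in> carrier G" and h: "h \<in> Z"
    have "commutator G (inv h) g \<in> Z"
      using comm[of "inv h" g] g h Z by (auto simp: subgroup.m_inv_closed)
    then have "h \<otimes> commutator G (inv h) g \<in> Z" using h Z by (simp add: subgroup.m_closed)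
    moreover have "h \<otimes> commutator G (inv h) g = g \<otimes> h \<otimes> inv g"
      using g Zc[OF h] by (simp add: commutator_def m_assoc[symmetric])
    ultimately show "g \<otimes> h \<otimes> inv g \<in> Z" by simp
  qed
  then show ?thesis using N Z pw comm by (auto simp: central_step_def)
qed

lemma coset_representatives:
  assumes N: "subgroup N G" and Z: "subgroup Z G" "N \<subseteq> Z" "card Z = m * card N"
  obtains R where "R \<subseteq> Z" "finite R" "card R \<le> m" "\<And>z. z \<in> Z \<Longrightarrow> \<exists>r\<in>R. \<exists>y\<in>N. z = r \<otimes> y"
proof -
  interpret Z: group "G\<lparr>carrier := Z\<rparr>" using Z subgroup_imp_group by blast
  have NZ: "subgroup N (G\<lparr>carrier := Z\<rparr>)" using subgroup_incl N Z by blast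
  let ?C = "rcosets\<^bsub>G\<lparr>carrier := Z\<rparr>\<^esub> N"
  have "card ?C * card N = m * card N"
    using Z.lagrange[OF NZ] Z by (simp add: order_def)
  then have cC: "card ?C = m" using card_subgroup_pos[OF N] by simp
  have fC: "finite ?C" using fin_subgroup[OF Z(1)] by (simp add: RCOSETS_def)
  define R where "R = (\<lambda>c. SOME r. r \<in> Z \<and> c = N #> r) ` ?C"
  have sel: "(SOME r. r \<in> Z \<and> c = N #> r) \<in> Z \<and> c = N #> (SOME r. r \<in> Z \<and> c = N #> r)"
    if "c \<in> ?C" for c
  proof -
    have "\<exists>r. r \<in> Z \<and> c = N #> r" using that by (auto simp: RCOSETS_def)
    then show ?thesis by (rule someI_ex)
  qed
  have inj: "inj_on (\<lambda>c. SOME r. r \<in> Z \<and> c = N #> r) ?C"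
    using sel by (intro inj_onI) metis
  have "\<exists>y\<in>N. \<exists>r\<in>R. z = y \<otimes> r" if z: "z \<in> Z" for z
  proof -
    have C: "N #> z \<in> ?C" using z by (auto simp: RCOSETS_def)
    have "z \<in> N #> z" using z N Z(1) rcos_self subgroup.mem_carrier by metis
    then have "z \<in> N #> (SOME r. r \<in> Z \<and> N #> z = N #> r)" using sel[OF C] by simp
    then show ?thesis using C unfolding r_coset_def R_def by blast
  qed
  note cover = this
  have RZ: "R \<subseteq> Z" using sel by (auto simp: R_def)
  have cR: "card R = m" "finite R" using inj cC fC by (simp_all add: R_def card_image)
  show ?thesis
  proof (rule that[of "m_inv G ` R"])
    show "m_inv G ` R \<subseteq> Z" using RZ Z by (auto simp: subgroup.m_inv_closed)
    show "finite (m_inv G ` R)" "card (m_inv G ` R) \<le> m"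
      using cR card_image_le[of R "m_inv G"] by auto
    fix z assume z: "z \<in> Z"
    then have "inv z \<in> Z" using Z by (simp add: subgroup.m_inv_closed)
    then obtain y r where yr: "y \<in> N" "r \<in> R" "inv z = y \<otimes> r" using cover by blast
    have car: "z \<in> carrier G" "y \<in> carrier G" "r \<in> carrier G"
      using z yr RZ subgroup.mem_carrier[OF Z(1)] subgroup.mem_carrier[OF N] by auto
    have "z = inv (y \<otimes> r)" using yr car by (metis inv_inv)
    then have "z = inv r \<otimes> inv y" using car by (simp add: inv_mult_group)
    then show "\<exists>r\<in>m_inv G ` R. \<exists>y\<in>N. z = r \<otimes> y"
      using yr subgroup.m_inv_closed[OF N yr(1)] by blast
  qed
qed

text \<open>
  If \<open>Z <#> T\<close> is all of \<open>K\<close>, then \<open>T\<close> is the only candidate for \<open>H\<close>, by Dedekind's law.  Otherwise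
  take an element \<open>x\<close> of \<open>K\<close> outside \<open>Z <#> T\<close>.  Each \<open>H\<close> contains \<open>inv r \<otimes> x\<close> for one of the \<open>p\<close>
  representatives \<open>r\<close> of \<open>Z\<close> modulo \<open>N\<close>, so that \<open>T\<close> can be enlarged by that element, which raises
  the order of \<open>Z <#> T\<close> by a factor of at least \<open>p\<close>.
\<close>
lemma card_complements_le:
  assumes N: "subgroup N G" and Z: "Z \<lhd> G" "N \<subseteq> Z" "card Z = p * card N"
    and K: "subgroup K G"
  shows "subgroup T G \<Longrightarrow> N \<subseteq> T \<Longrightarrow> card K \<le> p ^ j * card (Z <#> T) \<Longrightarrow>
    card {H. subgroup H G \<and> T \<subseteq> H \<and> Z \<inter> H = N \<and> Z <#> H = K} \<le> p ^ j"
proof (induction j arbitrary: T)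
  have Zs: "subgroup Z G" using Z normal_imp_subgroup by blast
  note Zc = subgroup.mem_carrier[OF Zs]
  let ?X = "\<lambda>T. {H. subgroup H G \<and> T \<subseteq> H \<and> Z \<inter> H = N \<and> Z <#> H = K}"
  have finX: "finite (?X T)" for T
    by (rule finite_subset[OF _ fin_subgroups]) auto
  have uniq: "card (?X T) \<le> 1" if T: "subgroup T G" "N \<subseteq> T" "Z <#> T = K" for T
  proof -
    have "H = T" if "H \<in> ?X T" for H
    proof
      have H: "subgroup H G" "T \<subseteq> H" "Z \<inter> H = N" "Z <#> H = K" using that by auto
      note Hc = subgroup.mem_carrier[OF H(1)]
      show "H \<subseteq> T"
      proof
        fix x assume x: "x \<in> H"
        have xc: "x \<in> carrier G" using Hc[OF x] .
        have "\<one> \<otimes> x \<in> Z <#> H" unfolding set_mult_def using x subgroup.one_closed[OF Zs] by blast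
        then have "x \<in> Z <#> T" using H T xc by simp
        then obtain z t where zt: "z \<in> Z" "t \<in> T" "x = z \<otimes> t" by (auto simp: set_mult_def)
        have tH: "t \<in> H" using zt H by blast
        have tc: "t \<in> carrier G" using Hc[OF tH] .
        have "z = x \<otimes> inv t" using zt Zc tc by (simp add: m_assoc)
        then have "z \<in> H" using x tH H(1) by (simp add: subgroup.m_closed subgroup.m_inv_closed)
        then have "z \<in> T" using zt H(3) T(2) by blast
        then show "x \<in> T" using zt T(1) by (simp add: subgroup.m_closed)
      qed
      show "T \<subseteq> H" using H(2) .
    qed
    then have "?X T \<subseteq> {T}" by blast
    then show ?thesis using card_mono[of "{T}" "?X T"] by simp
  qed
  \<comment> \<open>any \<open>H\<close> in the set shows that \<open>Z <#> T\<close> cannot exceed \<open>K\<close>\<close>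
  have sub: "Z <#> T \<subseteq> K" if "H \<in> ?X T" for H T
    using that mono_set_mult[of Z Z T H G] by auto
  {
    case 0
    show ?case
    proof (cases "?X T = {}")
      case False
      then obtain H where "H \<in> ?X T" by blast
      then have "Z <#> T = K"
        using sub 0 fin_subgroup[OF K] by (intro card_seteq) auto
      then show ?thesis using uniq 0 by simp
    qed (simp only: card.empty)
  next
    case (Suc j)
    show ?case
    proof (cases "Z <#> T = K \<or> ?X T = {}")
      case True
      then show ?thesis
      proof
        assume "Z <#> T = K"
        then have "card (?X T) \<le> 1" using uniq Suc.prems by blast
        also have "1 \<le> p ^ Suc j" using p_pos by simp
        finally show ?thesis .
      qed (simp only: card.empty)
    next
      case False
      then obtain x where x: "x \<in> K" "x \<notin> Z <#> T" using sub by blast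
      have xc: "x \<in> carrier G" using subgroup.mem_carrier[OF K x(1)] .
      obtain R where R: "R \<subseteq> Z" "finite R" "card R \<le> p" "\<And>z. z \<in> Z \<Longrightarrow> \<exists>r\<in>R. \<exists>y\<in>N. z = r \<otimes> y"
        using coset_representatives[OF N Zs Z(2,3)] by blast
      define U where "U r = generate G (insert (inv r \<otimes> x) T)" for r
      have Tc: "T \<subseteq> carrier G" using Suc.prems subgroup.subset by blast
      have U: "subgroup (U r) G" "T \<subseteq> U r" "inv r \<otimes> x \<in> U r" if "r \<in> R" for r
        using that R(1) Zc xc Tc unfolding U_def
        by (auto intro!: generate_is_subgroup generate.incl)
      have "card (?X (U r)) \<le> p ^ j" if r: "r \<in> R" for r
      proof (rule Suc.IH)
        show "subgroup (U r) G" using U(1)[OF r] .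
        show "N \<subseteq> U r" using U(2)[OF r] Suc.prems(2) by blast
        have "r \<otimes> (inv r \<otimes> x) \<in> Z <#> U r"
          unfolding set_mult_def using U r R(1) by blast
        then have "x \<in> Z <#> U r" using r R(1) Zc xc by (auto simp: m_assoc[symmetric])
        moreover have "Z <#> T \<subseteq> Z <#> U r" using U r mono_set_mult[of Z Z T "U r" G] by auto
        ultimately have "p * card (Z <#> T) \<le> card (Z <#> U r)"
          using x U r Suc.prems Z(1) by (intro card_proper_subgroup mult_norm_subgroup) auto
        then have "p ^ j * (p * card (Z <#> T)) \<le> p ^ j * card (Z <#> U r)"
          by (rule mult_le_mono2)
        then show "card K \<le> p ^ j * card (Z <#> U r)"
          using Suc.prems(3) by (simp only: power_Suc ac_simps)
      qed
      note IH = this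
      have "?X T \<subseteq> (\<Union>r\<in>R. ?X (U r))"
      proof
        fix H assume "H \<in> ?X T"
        then have H: "subgroup H G" "T \<subseteq> H" "Z \<inter> H = N" "Z <#> H = K" by auto
        then have "x \<in> Z <#> H" using x by blast
        then obtain z h where zh: "z \<in> Z" "h \<in> H" "x = z \<otimes> h" by (auto simp: set_mult_def)
        then obtain y r where yr: "y \<in> N" "r \<in> R" "z = r \<otimes> y" using R(4) by blast
        have hc: "h \<in> carrier G" using subgroup.mem_carrier[OF H(1) zh(2)] .
        have yc: "y \<in> carrier G" using subgroup.mem_carrier[OF N yr(1)] .
        have rc: "r \<in> carrier G" using Zc yr(2) R(1) by blast
        have "inv r \<otimes> x = y \<otimes> h"
          unfolding zh(3) yr(3) using yc hc rc by (simp add: m_assoc[symmetric])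
        moreover have "y \<otimes> h \<in> H" using yr zh H by (auto intro: subgroup.m_closed)
        ultimately have "U r \<subseteq> H" unfolding U_def using H by (intro generate_subgroup_incl) auto
        then show "H \<in> (\<Union>r\<in>R. ?X (U r))" using H yr by blast
      qed
      then have "card (?X T) \<le> card (\<Union>r\<in>R. ?X (U r))"
        using finX R by (intro card_mono) auto
      also have "\<dots> \<le> (\<Sum>r\<in>R. card (?X (U r)))" by (rule card_UN_le[OF R(2)])
      also have "\<dots> \<le> (\<Sum>r\<in>R. p ^ j)" by (intro sum_mono IH)
      also have "\<dots> \<le> p ^ Suc j" using R by simp
      finally show ?thesis .
    qed
  }
qed

end

lemma (in group) commutator_central:
  assumes "z \<in> carrier G" "w \<in> carrier G" "x \<in> carrier G" "y \<in> carrier G"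
    and z: "\<And>g. g \<in> carrier G \<Longrightarrow> z \<otimes> g = g \<otimes> z" and w: "\<And>g. g \<in> carrier G \<Longrightarrow> w \<otimes> g = g \<otimes> w"
  shows "commutator G (z \<otimes> x) (w \<otimes> y) = commutator G x y"
proof -
  define c where "c = z \<otimes> w"
  have c: "c \<in> carrier G" using assms(1,2) by (simp add: c_def)
  have cc: "c \<otimes> g = g \<otimes> c" if g: "g \<in> carrier G" for g
  proof -
    have "c \<otimes> g = z \<otimes> (w \<otimes> g)" using assms(1,2) g by (simp add: c_def m_assoc)
    also have "\<dots> = z \<otimes> (g \<otimes> w)" by (simp only: w[OF g])
    also have "\<dots> = (z \<otimes> g) \<otimes> w" using assms(1,2) g by (simp add: m_assoc)
    also have "\<dots> = (g \<otimes> z) \<otimes> w" by (simp only: z[OF g])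
    also have "\<dots> = g \<otimes> c" using assms(1,2) g by (simp add: c_def m_assoc)
    finally show ?thesis .
  qed
  have xy: "(z \<otimes> x) \<otimes> (w \<otimes> y) = c \<otimes> (x \<otimes> y)"
  proof -
    have "(z \<otimes> x) \<otimes> (w \<otimes> y) = z \<otimes> (x \<otimes> w) \<otimes> y" using assms(1-4) by (simp add: m_assoc)
    also have "\<dots> = z \<otimes> (w \<otimes> x) \<otimes> y" by (simp only: w[OF assms(3)])
    also have "\<dots> = c \<otimes> (x \<otimes> y)" using assms(1-4) by (simp add: c_def m_assoc)
    finally show ?thesis .
  qed
  have yx: "(w \<otimes> y) \<otimes> (z \<otimes> x) = c \<otimes> (y \<otimes> x)"
  proof -
    have "(w \<otimes> y) \<otimes> (z \<otimes> x) = w \<otimes> (y \<otimes> z) \<otimes> x" using assms(1-4) by (simp add: m_assoc)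
    also have "\<dots> = w \<otimes> (z \<otimes> y) \<otimes> x" by (simp only: z[OF assms(4)])
    also have "\<dots> = (w \<otimes> z) \<otimes> (y \<otimes> x)" using assms(1-4) by (simp add: m_assoc)
    also have "w \<otimes> z = c" by (simp only: z[OF assms(2)] c_def)
    finally show ?thesis .
  qed
  have "commutator G (z \<otimes> x) (w \<otimes> y) = (z \<otimes> x) \<otimes> (w \<otimes> y) \<otimes> inv ((w \<otimes> y) \<otimes> (z \<otimes> x))"
    using assms(1-4) by (simp add: commutator_def inv_mult_group m_assoc)
  also have "\<dots> = (x \<otimes> y) \<otimes> c \<otimes> (inv c \<otimes> inv (y \<otimes> x))"
    unfolding xy yx using assms(1-4) c cc[of "x \<otimes> y"] cc[of "y \<otimes> x"] by (simp add: inv_mult_group)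
  also have "\<dots> = (x \<otimes> y) \<otimes> (c \<otimes> inv c) \<otimes> inv (y \<otimes> x)"
    using assms(1-4) c by (simp only: m_assoc m_closed inv_closed)
  also have "\<dots> = commutator G x y"
    using assms(1-4) c by (simp add: commutator_def inv_mult_group m_assoc)
  finally show ?thesis .
qed

text \<open>
  The subgroups \<open>H\<close> for which \<open>H / N\<close> is a complement of \<open>Z / N\<close> in \<open>K / N\<close>.
\<close>
definition complements :: "('a, 'b) monoid_scheme \<Rightarrow> 'a set \<Rightarrow> 'a set \<Rightarrow> 'a set \<Rightarrow> 'a set set" where
  "complements G N Z K = {H. subgroup H G \<and> Z \<inter> H = N \<and> Z <#>\<^bsub>G\<^esub> H = K}"

context finite_p_group
begin

lemma central_stepD:
  assumes "central_step G p N Z"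
  shows "N \<lhd> G" "Z \<lhd> G" "subgroup N G" "subgroup Z G" "N \<subseteq> Z" "card Z = p * card N"
  using assms normal_imp_subgroup by (auto simp: central_step_def)

lemma central_step_quotient:
  assumes cs: "central_step G p N Z"
  obtains Q :: "'a set monoid" and f where "group_hom G Q f"
    "\<And>x. x \<in> carrier G \<Longrightarrow> f x = \<one>\<^bsub>Q\<^esub> \<longleftrightarrow> x \<in> N"
    "\<And>z. z \<in> Z \<Longrightarrow> f z [^]\<^bsub>Q\<^esub> p = \<one>\<^bsub>Q\<^esub>"
    "\<And>z g. z \<in> Z \<Longrightarrow> g \<in> carrier Q \<Longrightarrow> f z \<otimes>\<^bsub>Q\<^esub> g = g \<otimes>\<^bsub>Q\<^esub> f z"
proof -
  obtain Q :: "'a set monoid" and f where Q: "group_hom G Q f" "f ` carrier G = carrier Q"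
    and ker: "\<And>x. x \<in> carrier G \<Longrightarrow> f x = \<one>\<^bsub>Q\<^esub> \<longleftrightarrow> x \<in> N"
    using quotient_hom[OF central_stepD(1)[OF cs]] by metis
  interpret f: group_hom G Q f by fact
  note Zc = subgroup.mem_carrier[OF central_stepD(4)[OF cs]]
  have "f z [^]\<^bsub>Q\<^esub> p = \<one>\<^bsub>Q\<^esub>" if "z \<in> Z" for z
    using ker[of "z [^] p"] cs that Zc[OF that] by (simp add: central_step_def f.hom_nat_pow)
  moreover have "f z \<otimes>\<^bsub>Q\<^esub> g = g \<otimes>\<^bsub>Q\<^esub> f z" if z: "z \<in> Z" and g: "g \<in> carrier Q" for z g
  proof -
    obtain u where u: "u \<in> carrier G" "g = f u" using g Q(2) by blast
    have "commutator G z u \<in> N" using cs z u by (simp add: central_step_def)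
    then have "f (commutator G z u) = \<one>\<^bsub>Q\<^esub>" using ker Zc[OF z] u by blast
    then show ?thesis using f.commutator_trivial_iff[OF Zc[OF z] u(1)] u by simp
  qed
  ultimately show ?thesis using that[of Q f] Q(1) ker by blast
qed

text \<open>
  Modulo \<open>N\<close>, the element \<open>z\<close> is central and has order dividing \<open>p\<close>, so it does not affect \<open>p\<close>-th
  powers.
\<close>
lemma pow_mod_central:
  assumes cs: "central_step G p N Z" and A: "subgroup A G" "N \<subseteq> A" and z: "z \<in> Z" and x: "x \<in> carrier G"
  shows "(z \<otimes> x) [^] p \<in> A \<longleftrightarrow> x [^] p \<in> A"
proof -
  obtain Q :: "'a set monoid" and f where Q: "group_hom G Q f"
    and ker: "\<And>x. x \<in> carrier G \<Longrightarrow> f x = \<one>\<^bsub>Q\<^esub> \<longleftrightarrow> x \<in> N"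
    and pw: "\<And>z. z \<in> Z \<Longrightarrow> f z [^]\<^bsub>Q\<^esub> p = \<one>\<^bsub>Q\<^esub>"
    and ce: "\<And>z g. z \<in> Z \<Longrightarrow> g \<in> carrier Q \<Longrightarrow> f z \<otimes>\<^bsub>Q\<^esub> g = g \<otimes>\<^bsub>Q\<^esub> f z"
    using central_step_quotient[OF cs] by metis
  interpret f: group_hom G Q f by fact
  have zc: "z \<in> carrier G" using subgroup.mem_carrier[OF central_stepD(4)[OF cs] z] .
  have "f ((z \<otimes> x) [^] p) = f (x [^] p)"
    using zc x pw[OF z] ce[OF z, of "f x"] by (simp add: f.hom_nat_pow f.H.pow_mult_distrib)
  then show ?thesis
    using zc x ker A by (intro f.same_image_mem_iff) auto
qed

lemma commutator_mod_central:
  assumes cs: "central_step G p N Z" and A: "subgroup A G" "N \<subseteq> A"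
    and zw: "z \<in> Z" "w \<in> Z" and xy: "x \<in> carrier G" "y \<in> carrier G"
  shows "commutator G (z \<otimes> x) (w \<otimes> y) \<in> A \<longleftrightarrow> commutator G x y \<in> A"
proof -
  obtain Q :: "'a set monoid" and f where Q: "group_hom G Q f"
    and ker: "\<And>x. x \<in> carrier G \<Longrightarrow> f x = \<one>\<^bsub>Q\<^esub> \<longleftrightarrow> x \<in> N"
    and pw: "\<And>z. z \<in> Z \<Longrightarrow> f z [^]\<^bsub>Q\<^esub> p = \<one>\<^bsub>Q\<^esub>"
    and ce: "\<And>z g. z \<in> Z \<Longrightarrow> g \<in> carrier Q \<Longrightarrow> f z \<otimes>\<^bsub>Q\<^esub> g = g \<otimes>\<^bsub>Q\<^esub> f z"
    using central_step_quotient[OF cs] by metis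
  interpret f: group_hom G Q f by fact
  have zc: "z \<in> carrier G" "w \<in> carrier G"
    using subgroup.mem_carrier[OF central_stepD(4)[OF cs]] zw by auto
  have comm: "f (commutator G u v) = commutator Q (f u) (f v)" if "u \<in> carrier G" "v \<in> carrier G" for u v
    using that by (simp add: commutator_def)
  have "f (commutator G (z \<otimes> x) (w \<otimes> y)) = f (commutator G x y)"
    using zc xy f.H.commutator_central[of "f z" "f w" "f x" "f y"] ce[OF zw(1)] ce[OF zw(2)]
    by (simp only: comm f.hom_mult f.hom_closed m_closed)
  then show ?thesis
    using zc xy ker A by (intro f.same_image_mem_iff) auto
qed

text \<open>
  The index of \<open>N\<close> in \<open>Z\<close> is the prime \<open>p\<close>, so nothing lies strictly between them.
\<close>
lemma complement_of_not_above:
  assumes cs: "central_step G p N Z" and H: "H \<in> subgroups_above G p N k" and nZ: "\<not> Z \<subseteq> H"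
  shows "Z \<inter> H = N" "Z <#> H \<in> subgroups_above G p Z k"
proof -
  note D = central_stepD[OF cs]
  have H: "subgroup H G" "N \<subseteq> H" "card H = p ^ k * card N"
    using H by (auto simp: subgroups_above_def)
  have I: "subgroup (Z \<inter> H) G" using D H subgroups_Inter_pair by blast
  show NI: "Z \<inter> H = N"
  proof (rule ccontr)
    assume "Z \<inter> H \<noteq> N"
    then have "p * card N \<le> card (Z \<inter> H)"
      using D H by (intro card_proper_subgroup I) auto
    moreover have "p * card (Z \<inter> H) \<le> card Z"
      using D nZ by (intro card_proper_subgroup I) auto
    ultimately have "p * (p * card N) \<le> p * card N"
      using D(6) by (metis mult_le_mono2 order_trans)
    then show False using p_gt_1 card_subgroup_pos[OF D(3)] by simp
  qed
  have "card (Z <#> H) * card N = card Z * card H"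
    using card_set_mult[OF D(4) fin_subgroup[OF D(4)] H(1) fin_subgroup[OF H(1)]] NI by simp
  also have "\<dots> = (p ^ k * card Z) * card N" using H(3) by simp
  finally have "card (Z <#> H) = p ^ k * card Z"
    using card_subgroup_pos[OF D(3)] by simp
  moreover have "subgroup (Z <#> H) G" using D H by (intro mult_norm_subgroup)
  moreover have "Z \<subseteq> Z <#> H"
  proof
    fix z assume z: "z \<in> Z"
    then have "z \<otimes> \<one> \<in> Z <#> H" unfolding set_mult_def using subgroup.one_closed[OF H(1)] by blast
    then show "z \<in> Z <#> H" using subgroup.mem_carrier[OF D(4) z] by simp
  qed
  ultimately show "Z <#> H \<in> subgroups_above G p Z k" by (simp add: subgroups_above_def)
qed

lemma fin_complements: "finite (complements G N Z K)"
  by (rule finite_subset[OF _ fin_subgroups]) (auto simp: complements_def)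

lemma card_complements:
  assumes cs: "central_step G p N Z" and K: "K \<in> subgroups_above G p Z k"
  shows "card (complements G N Z K) \<le> p ^ k"
proof -
  note D = central_stepD[OF cs]
  have K': "subgroup K G" "card K = p ^ k * card Z" using K by (auto simp: subgroups_above_def)
  have "Z <#> N = Z" using set_mult_subgroup_idem[OF D(4) subgroup_incl[OF D(3,4,5)]] .
  then have "card {H. subgroup H G \<and> N \<subseteq> H \<and> Z \<inter> H = N \<and> Z <#> H = K} \<le> p ^ k"
    using K' by (intro card_complements_le[OF D(3) D(2) D(5,6)] D(3)) auto
  moreover have "complements G N Z K = {H. subgroup H G \<and> N \<subseteq> H \<and> Z \<inter> H = N \<and> Z <#> H = K}"
    by (auto simp: complements_def)
  ultimately show ?thesis by simp
qed

text \<open>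
  Some \<open>p\<close>-th power or commutator \<open>t\<close> of elements of \<open>K\<close> lies outside \<open>Z\<close>.  Changing these elements by
  elements of \<open>Z\<close> does not affect \<open>t\<close> modulo \<open>N\<close>, so they may be taken from any given complement,
  and \<open>t\<close> lies in all complements.  Starting \<open>card_complements_le\<close> from the subgroup generated by \<open>N\<close>
  and \<open>t\<close> saves a factor \<open>p\<close>.
\<close>
lemma card_complements_not_elementary:
  assumes cs: "central_step G p N Z" and K: "K \<in> subgroups_above G p Z (Suc k)"
    and not_elementary: "\<not> elementary_abelian_mod G p Z K"
  shows "card (complements G N Z K) \<le> p ^ k"
proof (cases "complements G N Z K = {}")
  case False
  note D = central_stepD[OF cs]
  have K': "subgroup K G" "card K = p ^ Suc k * card Z" using K by (auto simp: subgroups_above_def)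
  obtain H\<^sub>0 where H0: "subgroup H\<^sub>0 G" "Z \<inter> H\<^sub>0 = N" "Z <#> H\<^sub>0 = K"
    using False by (auto simp: complements_def)
  have decomp: "\<exists>z\<in>Z. \<exists>h\<in>H. x = z \<otimes> h" if "Z <#> H = K" "x \<in> K" for x H
    using that by (auto simp: set_mult_def)
  have "\<exists>t\<in>H\<^sub>0. t \<notin> Z \<and> (\<forall>H\<in>complements G N Z K. t \<in> H)"
  proof -
    consider x where "x \<in> K" "x [^] p \<notin> Z"
      | x y where "x \<in> K" "y \<in> K" "commutator G x y \<notin> Z"
      using not_elementary by (auto simp: elementary_abelian_mod_def)
    then show ?thesis
    proof cases
      case 1
      obtain z h where zh: "z \<in> Z" "h \<in> H\<^sub>0" "x = z \<otimes> h" using decomp[OF H0(3) 1(1)] by blast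
      have hc: "h \<in> carrier G" using subgroup.mem_carrier[OF H0(1) zh(2)] .
      have "h [^] p \<notin> Z" using 1 pow_mod_central[OF cs D(4,5) zh(1) hc] zh by simp
      moreover have inH: "h [^] p \<in> H" if H: "subgroup H G" "N \<subseteq> H" "Z <#> H = K" and h: "h \<in> K" for H
      proof -
        obtain w g where wg: "w \<in> Z" "g \<in> H" "h = w \<otimes> g" using decomp[OF H(3) h] by blast
        have "g [^] p \<in> H"
          by (induction p) (use wg H in \<open>auto simp: subgroup.m_closed subgroup.one_closed\<close>)
        then show ?thesis
          using pow_mod_central[OF cs H(1,2) wg(1) subgroup.mem_carrier[OF H(1) wg(2)]] wg by simp
      qed
      moreover have "h \<in> K"
      proof -
        have "\<one> \<otimes> h \<in> Z <#> H\<^sub>0" unfolding set_mult_def using zh subgroup.one_closed[OF D(4)] by blast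
        then show ?thesis using H0 hc by simp
      qed
      ultimately have "h [^] p \<in> H\<^sub>0" "\<forall>H\<in>complements G N Z K. h [^] p \<in> H"
        using H0 by (auto simp: complements_def intro!: inH)
      then show ?thesis using \<open>h [^] p \<notin> Z\<close> by blast
    next
      case 2
      obtain z h where zh: "z \<in> Z" "h \<in> H\<^sub>0" "x = z \<otimes> h" using decomp[OF H0(3) 2(1)] by blast
      obtain w g where wg: "w \<in> Z" "g \<in> H\<^sub>0" "y = w \<otimes> g" using decomp[OF H0(3) 2(2)] by blast
      have hc: "h \<in> carrier G" "g \<in> carrier G"
        using subgroup.mem_carrier[OF H0(1)] zh(2) wg(2) by auto
      have "commutator G h g \<notin> Z"
        using 2 commutator_mod_central[OF cs D(4,5) zh(1) wg(1) hc] zh wg by simp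
      moreover have inH: "commutator G h g \<in> H"
        if H: "subgroup H G" "N \<subseteq> H" "Z <#> H = K" and hK: "h \<in> K" "g \<in> K" for H
      proof -
        obtain u a where ua: "u \<in> Z" "a \<in> H" "h = u \<otimes> a" using decomp[OF H(3) hK(1)] by blast
        obtain v b where vb: "v \<in> Z" "b \<in> H" "g = v \<otimes> b" using decomp[OF H(3) hK(2)] by blast
        have "commutator G a b \<in> H"
          using ua vb H(1) by (simp add: commutator_def subgroup.m_closed subgroup.m_inv_closed)
        then show ?thesis
          using commutator_mod_central[OF cs H(1,2) ua(1) vb(1)
              subgroup.mem_carrier[OF H(1) ua(2)] subgroup.mem_carrier[OF H(1) vb(2)]] ua vb by simp
      qed
      moreover have "k \<in> K" if "k \<in> H\<^sub>0" for k
      proof -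
        have "\<one> \<otimes> k \<in> Z <#> H\<^sub>0" unfolding set_mult_def using that subgroup.one_closed[OF D(4)] by blast
        then show ?thesis using H0 subgroup.mem_carrier[OF H0(1) that] by simp
      qed
      then have "h \<in> K" "g \<in> K" using zh wg by auto
      ultimately have "commutator G h g \<in> H\<^sub>0" "\<forall>H\<in>complements G N Z K. commutator G h g \<in> H"
        using H0 by (auto simp: complements_def intro!: inH)
      then show ?thesis using \<open>commutator G h g \<notin> Z\<close> by blast
    qed
  qed
  then obtain t where t: "t \<in> H\<^sub>0" "t \<notin> Z" "\<And>H. H \<in> complements G N Z K \<Longrightarrow> t \<in> H" by blast
  have tc: "t \<in> carrier G" using subgroup.mem_carrier[OF H0(1) t(1)] .
  define T where "T = generate G (insert t N)"
  have T: "subgroup T G" "N \<subseteq> T" "t \<in> T"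
    unfolding T_def using tc subgroup.subset[OF D(3)]
    by (auto intro!: generate_is_subgroup generate.incl)
  have "Z \<subset> Z <#> T"
  proof
    show "Z \<subseteq> Z <#> T"
    proof
      fix z assume z: "z \<in> Z"
      then have "z \<otimes> \<one> \<in> Z <#> T" unfolding set_mult_def using subgroup.one_closed[OF T(1)] by blast
      then show "z \<in> Z <#> T" using subgroup.mem_carrier[OF D(4) z] by simp
    qed
    have "\<one> \<otimes> t \<in> Z <#> T" unfolding set_mult_def using T subgroup.one_closed[OF D(4)] by blast
    then show "Z \<noteq> Z <#> T" using tc t(2) by auto
  qed
  then have "p * card Z \<le> card (Z <#> T)"
    using D T by (intro card_proper_subgroup mult_norm_subgroup) auto
  then have "p ^ k * (p * card Z) \<le> p ^ k * card (Z <#> T)" by (rule mult_le_mono2)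
  then have "card {H. subgroup H G \<and> T \<subseteq> H \<and> Z \<inter> H = N \<and> Z <#> H = K} \<le> p ^ k"
    using K' T by (intro card_complements_le[OF D(3) D(2) D(5,6)]) (simp_all add: ac_simps)
  moreover have "complements G N Z K = {H. subgroup H G \<and> T \<subseteq> H \<and> Z \<inter> H = N \<and> Z <#> H = K}"
  proof (intro Set.set_eqI iffI)
    fix H assume "H \<in> complements G N Z K"
    moreover from this have "T \<subseteq> H"
      unfolding T_def using t(3) by (intro generate_subgroup_incl) (auto simp: complements_def)
    ultimately show "H \<in> {H. subgroup H G \<and> T \<subseteq> H \<and> Z \<inter> H = N \<and> Z <#> H = K}"
      by (simp add: complements_def)
  qed (simp add: complements_def)
  ultimately show ?thesis by simp
qed simp

lemma above_zero:
  assumes "subgroup N G"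
  shows "subgroups_above G p N 0 = {N}"
proof -
  have "H = N" if "subgroup H G" "N \<subseteq> H" "card H = card N" for H
    using that fin_subgroup[OF that(1)] card_subset_eq by metis
  then show ?thesis using assms by (auto simp: subgroups_above_def)
qed

lemma above_step:
  assumes "central_step G p N Z"
  shows "{H \<in> subgroups_above G p N (Suc k). Z \<subseteq> H} = subgroups_above G p Z k"
  using central_stepD[OF assms] by (auto simp: subgroups_above_def)

section \<open>Recursive bounds for the number of subgroups\<close>

text \<open>
  Every member of \<open>S\<close> contains \<open>Z\<close> or is a complement of \<open>Z\<close> in a group belonging to \<open>T\<close>.
\<close>
lemma card_above_split:
  assumes cs: "central_step G p N Z" and S: "S \<subseteq> subgroups_above G p N k" and T: "finite T"
    and ST: "\<And>H. H \<in> S \<Longrightarrow> Z \<inter> H = N \<Longrightarrow> Z <#> H \<in> subgroups_above G p Z k \<Longrightarrow> Z <#> H \<in> T"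
  shows "card S \<le> card {H \<in> S. Z \<subseteq> H} + (\<Sum>K\<in>T. card (complements G N Z K))"
proof -
  have finS: "finite S" using S fin_above finite_subset by blast
  have "S \<subseteq> {H \<in> S. Z \<subseteq> H} \<union> (\<Union>K\<in>T. complements G N Z K)"
  proof
    fix H assume H: "H \<in> S"
    show "H \<in> {H \<in> S. Z \<subseteq> H} \<union> (\<Union>K\<in>T. complements G N Z K)"
    proof (cases "Z \<subseteq> H")
      case False
      have *: "H \<in> subgroups_above G p N k" using H S by blast
      have "H \<in> complements G N Z (Z <#> H)"
        using complement_of_not_above(1)[OF cs * False] * by (simp add: complements_def subgroups_above_def)
      then show ?thesis using ST[OF H complement_of_not_above[OF cs * False]] by blast
    qed (use H in simp)
  qed
  then have "card S \<le> card ({H \<in> S. Z \<subseteq> H} \<union> (\<Union>K\<in>T. complements G N Z K))"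
    using finS T fin_complements by (intro card_mono) auto
  also have "\<dots> \<le> card {H \<in> S. Z \<subseteq> H} + card (\<Union>K\<in>T. complements G N Z K)"
    by (rule card_Un_le)
  also have "card (\<Union>K\<in>T. complements G N Z K) \<le> (\<Sum>K\<in>T. card (complements G N Z K))"
    by (rule card_UN_le[OF T])
  finally show ?thesis by simp
qed

lemma card_above_split_uniform:
  assumes cs: "central_step G p N Z" and S: "S \<subseteq> subgroups_above G p N k"
    and T: "T \<subseteq> subgroups_above G p Z k"
    and ST: "\<And>H. H \<in> S \<Longrightarrow> Z \<inter> H = N \<Longrightarrow> Z <#> H \<in> subgroups_above G p Z k \<Longrightarrow> Z <#> H \<in> T"
  shows "card S \<le> card {H \<in> S. Z \<subseteq> H} + p ^ k * card T"
proof -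
  have "card S \<le> card {H \<in> S. Z \<subseteq> H} + (\<Sum>K\<in>T. card (complements G N Z K))"
    using T fin_above finite_subset by (intro card_above_split[OF cs S _ ST]) blast+
  also have "(\<Sum>K\<in>T. card (complements G N Z K)) \<le> (\<Sum>K\<in>T. p ^ k)"
    using T card_complements[OF cs] by (intro sum_mono) blast
  finally show ?thesis by (simp add: mult.commute)
qed

lemma elementary_abelian_mod_mono: "elementary_abelian_mod G p N H \<Longrightarrow> N \<subseteq> Z \<Longrightarrow> H' \<subseteq> H \<Longrightarrow> elementary_abelian_mod G p Z H'"
  unfolding elementary_abelian_mod_def by blast

lemma elementary_abelian_mod_set_mult:
  assumes cs: "central_step G p N Z" and A: "subgroup A G" "N \<subseteq> A" and H: "subgroup H G"
    and elab: "elementary_abelian_mod G p A H"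
  shows "elementary_abelian_mod G p A (Z <#> H)"
proof -
  note Hc = subgroup.mem_carrier[OF H]
  have "x [^] p \<in> A" if "x \<in> Z <#> H" for x
    using that elab pow_mod_central[OF cs A _ Hc] by (auto simp: set_mult_def elementary_abelian_mod_def)
  moreover have "commutator G x y \<in> A" if "x \<in> Z <#> H" "y \<in> Z <#> H" for x y
    using that elab commutator_mod_central[OF cs A _ _ Hc Hc] by (auto simp: set_mult_def elementary_abelian_mod_def)
  ultimately show ?thesis by (simp add: elementary_abelian_mod_def)
qed

text \<open>
  No group of order \<open>p ^ m\<close> has more subgroups of order \<open>p ^ k\<close> than the elementary abelian one: with
  the bound \<open>p ^ k\<close> for the number of complements, the recursion becomes that of the Gaussian
  binomials.
\<close>
lemma card_above_le_gauss_binomial: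
  "N \<lhd> G \<Longrightarrow> order G = p ^ m * card N \<Longrightarrow> card (subgroups_above G p N k) \<le> gauss_binomial p m k"
proof (induction m arbitrary: N k)
  case 0
  have N: "subgroup N G" using 0 normal_imp_subgroup by blast
  show ?case
  proof (cases k)
    case 0
    then show ?thesis using above_zero[OF N] by simp
  next
    case (Suc j)
    have False if "H \<in> subgroups_above G p N k" for H
    proof -
      have H: "subgroup H G" "card H = p ^ Suc j * card N" using that Suc by (auto simp: subgroups_above_def)
      have "card H \<le> card N"
        using card_mono[OF fin_carrier subgroup.subset[OF H(1)]] 0 by (simp add: order_def)
      moreover have "p ^ Suc j > 1" using p_gt_1 one_less_power by blast
      ultimately show False using H card_subgroup_pos[OF N] by simp
    qed
    then show ?thesis by (metis card.empty equals0I zero_le)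
  qed
next
  case (Suc m)
  have N: "subgroup N G" using Suc normal_imp_subgroup by blast
  show ?case
  proof (cases k)
    case 0
    then show ?thesis using above_zero[OF N] by simp
  next
    case (Suc j)
    obtain Z where cs: "central_step G p N Z" using central_step_exists Suc.prems by blast
    note D = central_stepD[OF cs]
    have oZ: "order G = p ^ m * card Z" using Suc.prems D by simp
    have "card (subgroups_above G p N k) \<le> card {H \<in> subgroups_above G p N k. Z \<subseteq> H}
        + p ^ k * card (subgroups_above G p Z k)"
      by (intro card_above_split_uniform[OF cs]) auto
    also have "\<dots> \<le> gauss_binomial p m j + p ^ k * gauss_binomial p m k"
      unfolding Suc above_step[OF cs] by (intro add_mono mult_le_mono order_refl Suc.IH D oZ)
    finally show ?thesis unfolding Suc by simp
  qed
qed

lemma card_above_within_le: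
  assumes N: "N \<lhd> G" and A: "subgroup A G" "N \<subseteq> A" "card A = p ^ m * card N"
  shows "card {H \<in> subgroups_above G p N k. H \<subseteq> A} \<le> gauss_binomial p m k"
proof -
  obtain i where "finite_p_group (G\<lparr>carrier := A\<rparr>) p i" using finite_p_group_subgroup[OF A(1)] by blast
  then interpret A: finite_p_group "G\<lparr>carrier := A\<rparr>" p i .
  have "{H \<in> subgroups_above G p N k. H \<subseteq> A} = subgroups_above (G\<lparr>carrier := A\<rparr>) p N k"
    using subgroup_incl[OF _ A(1)] incl_subgroup[OF A(1)] subgroup.subset
    by (fastforce simp: subgroups_above_def)
  then show ?thesis
    using A.card_above_le_gauss_binomial[OF normal_restrict_supergroup[OF A(1) N A(2)]] A(3)
    by (simp add: order_def)
qed

end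

definition elementary_subgroups_above :: "('a, 'b) monoid_scheme \<Rightarrow> nat \<Rightarrow> 'a set \<Rightarrow> nat \<Rightarrow> 'a set set" where
  "elementary_subgroups_above G p N k = {H \<in> subgroups_above G p N k. elementary_abelian_mod G p N H}"

lemma (in group) conjugates_eq_imp_commute:
  assumes "a \<in> carrier G" "b \<in> carrier G" "c \<in> carrier G"
    and "commutator G a c = commutator G b c"
  shows "(inv a \<otimes> b) \<otimes> c = c \<otimes> (inv a \<otimes> b)"
proof -
  have "a \<otimes> c \<otimes> inv a = b \<otimes> c \<otimes> inv b"
    using assms by (simp add: commutator_def)
  then have "inv a \<otimes> (a \<otimes> c \<otimes> inv a) \<otimes> b = inv a \<otimes> (b \<otimes> c \<otimes> inv b) \<otimes> b" by simp
  moreover have "inv a \<otimes> (a \<otimes> c \<otimes> inv a) \<otimes> b = c \<otimes> (inv a \<otimes> b)"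
    using assms(1-3) by (simp add: m_assoc[symmetric])
  moreover have "inv a \<otimes> (b \<otimes> c \<otimes> inv b) \<otimes> b = (inv a \<otimes> b) \<otimes> c"
    using assms(1-3) by (simp add: m_assoc)
  ultimately show ?thesis by simp
qed

context finite_p_group
begin

text \<open>
  The elementary abelian \<open>K\<close> modulo \<open>Z\<close> contribute at most \<open>p ^ (k + 1)\<close> complements each, the others
  at most \<open>p ^ k\<close>.
\<close>
lemma card_above_rec:
  assumes cs: "central_step G p N Z"
  shows "card (subgroups_above G p N (Suc k)) \<le> card (subgroups_above G p Z k)
     + (p ^ Suc k - p ^ k) * card (elementary_subgroups_above G p Z (Suc k))
     + p ^ k * card (subgroups_above G p Z (Suc k))"
proof -
  let ?Y = "subgroups_above G p Z (Suc k)" and ?E = "elementary_subgroups_above G p Z (Suc k)"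
  have EY: "?E \<subseteq> ?Y" by (auto simp: elementary_subgroups_above_def)
  have fY: "finite ?Y" by (rule fin_above)
  obtain c where c: "p ^ Suc k = p ^ k + c"
    using p_pos by (metis le_iff_add le_add2 mult_le_mono1 nat_mult_1 power_Suc Suc_leI One_nat_def)
  have cY: "card ?Y = card ?E + card (?Y - ?E)"
    using card_Diff_subset[OF finite_subset[OF EY fY] EY] card_mono[OF fY EY] by simp
  have "card (subgroups_above G p N (Suc k)) \<le> card {H \<in> subgroups_above G p N (Suc k). Z \<subseteq> H}
      + (\<Sum>K\<in>?Y. card (complements G N Z K))"
    by (intro card_above_split[OF cs _ fY]) auto
  also have "(\<Sum>K\<in>?Y. card (complements G N Z K))
      = (\<Sum>K\<in>?Y - ?E. card (complements G N Z K)) + (\<Sum>K\<in>?E. card (complements G N Z K))"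
    by (rule sum.subset_diff[OF EY fY])
  also have "\<dots> \<le> (\<Sum>K\<in>?Y - ?E. p ^ k) + (\<Sum>K\<in>?E. p ^ Suc k)"
    using EY by (intro add_mono sum_mono card_complements_not_elementary[OF cs] card_complements[OF cs])
      (auto simp: elementary_subgroups_above_def)
  also have "\<dots> = (p ^ Suc k - p ^ k) * card ?E + p ^ k * card ?Y"
    unfolding cY by (simp only: sum_constant c of_nat_id add_diff_cancel_left') (simp add: algebra_simps)
  finally show ?thesis by (simp add: above_step[OF cs])
qed

text \<open>
  A complement in \<open>K\<close> is isomorphic to \<open>K / Z\<close>, hence if it is elementary abelian, so is \<open>K / Z\<close>.
\<close>
lemma card_elementary_above_rec:
  assumes cs: "central_step G p N Z"
  shows "card (elementary_subgroups_above G p N (Suc k)) \<le> card (elementary_subgroups_above G p Z k)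
     + p ^ Suc k * card (elementary_subgroups_above G p Z (Suc k))"
proof -
  note D = central_stepD[OF cs]
  have "card (elementary_subgroups_above G p N (Suc k)) \<le> card {H \<in> elementary_subgroups_above G p N (Suc k). Z \<subseteq> H}
     + p ^ Suc k * card (elementary_subgroups_above G p Z (Suc k))"
  proof (rule card_above_split_uniform[OF cs])
    fix H assume H: "H \<in> elementary_subgroups_above G p N (Suc k)" and *: "Z <#> H \<in> subgroups_above G p Z (Suc k)"
    have "elementary_abelian_mod G p Z (Z <#> H)"
      using H elementary_abelian_mod_mono[OF _ D(5) order_refl]
      by (intro elementary_abelian_mod_set_mult[OF cs D(4,5)]) (auto simp: elementary_subgroups_above_def subgroups_above_def)
    then show "Z <#> H \<in> elementary_subgroups_above G p Z (Suc k)" using * by (simp add: elementary_subgroups_above_def)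
  qed (auto simp: elementary_subgroups_above_def)
  moreover have "{H \<in> elementary_subgroups_above G p N (Suc k). Z \<subseteq> H} \<subseteq> elementary_subgroups_above G p Z k"
    using above_step[OF cs] elementary_abelian_mod_mono[OF _ D(5) order_refl] by (auto simp: elementary_subgroups_above_def)
  then have "card {H \<in> elementary_subgroups_above G p N (Suc k). Z \<subseteq> H} \<le> card (elementary_subgroups_above G p Z k)"
    using fin_above by (intro card_mono) (auto simp: elementary_subgroups_above_def)
  ultimately show ?thesis by linarith
qed

text \<open>
  If \<open>G / Z\<close> is elementary abelian, then powers and commutators of elements of \<open>H\<close> lie in
  \<open>Z \<inter> H = N\<close>, so that \<open>H / N\<close> and then its product with the central subgroup \<open>Z / N\<close> are elementary
  abelian.
\<close>
lemma complement_product_elementary: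
  assumes cs: "central_step G p N Z" and el: "elementary_abelian_mod G p Z (carrier G)"
    and H: "subgroup H G" "Z \<inter> H = N"
  shows "elementary_abelian_mod G p N (Z <#> H)"
proof (rule elementary_abelian_mod_set_mult[OF cs central_stepD(3)[OF cs] order_refl H(1)])
  note Hc = subgroup.mem_carrier[OF H(1)]
  have "x [^] p \<in> N" if "x \<in> H" for x
  proof -
    have "x [^] p \<in> H"
      by (induction p) (use that H in \<open>auto simp: subgroup.m_closed subgroup.one_closed\<close>)
    then show ?thesis using el Hc[OF that] H by (auto simp: elementary_abelian_mod_def)
  qed
  moreover have "commutator G x y \<in> N" if "x \<in> H" "y \<in> H" for x y
  proof -
    have "commutator G x y \<in> H"
      using that H(1) by (simp add: commutator_def subgroup.m_closed subgroup.m_inv_closed)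
    then show ?thesis using el Hc that H by (auto simp: elementary_abelian_mod_def)
  qed
  ultimately show "elementary_abelian_mod G p N H" by (simp add: elementary_abelian_mod_def)
qed

lemma card_above_via_isotropic:
  assumes cs: "central_step G p N Z" and el: "elementary_abelian_mod G p Z (carrier G)"
  shows "card (subgroups_above G p N k) \<le> card {H \<in> subgroups_above G p N k. Z \<subseteq> H}
     + p ^ k * card {K \<in> subgroups_above G p Z k. elementary_abelian_mod G p N K}"
proof (rule card_above_split_uniform[OF cs])
  fix H assume H: "H \<in> subgroups_above G p N k" "Z \<inter> H = N" and *: "Z <#> H \<in> subgroups_above G p Z k"
  have "subgroup H G" using H by (simp add: subgroups_above_def)
  then show "Z <#> H \<in> {K \<in> subgroups_above G p Z k. elementary_abelian_mod G p N K}"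
    using complement_product_elementary[OF cs el _ H(2)] * by simp
qed auto

lemma card_elementary_above_via_isotropic:
  assumes cs: "central_step G p N Z" and el: "elementary_abelian_mod G p Z (carrier G)"
  shows "card (elementary_subgroups_above G p N (Suc k)) \<le> card {K \<in> subgroups_above G p Z k. elementary_abelian_mod G p N K}
     + p ^ Suc k * card {K \<in> subgroups_above G p Z (Suc k). elementary_abelian_mod G p N K}"
proof -
  have "{H \<in> elementary_subgroups_above G p N (Suc k). Z \<subseteq> H} = {K \<in> subgroups_above G p Z k. elementary_abelian_mod G p N K}"
    using above_step[OF cs, of k] by (auto simp: elementary_subgroups_above_def)
  moreover have "card (elementary_subgroups_above G p N (Suc k))
      \<le> card {H \<in> elementary_subgroups_above G p N (Suc k). Z \<subseteq> H}
        + p ^ Suc k * card {K \<in> subgroups_above G p Z (Suc k). elementary_abelian_mod G p N K}"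
  proof (rule card_above_split_uniform[OF cs])
    fix H assume H: "H \<in> elementary_subgroups_above G p N (Suc k)" "Z \<inter> H = N"
      and *: "Z <#> H \<in> subgroups_above G p Z (Suc k)"
    have "subgroup H G" using H by (simp add: elementary_subgroups_above_def subgroups_above_def)
    then show "Z <#> H \<in> {K \<in> subgroups_above G p Z (Suc k). elementary_abelian_mod G p N K}"
      using complement_product_elementary[OF cs el _ H(2)] * by simp
  qed (auto simp: elementary_subgroups_above_def)
  ultimately show ?thesis by simp
qed

section \<open>Isotropic subspaces\<close>

text \<open>
  A substitute for the homomorphism theorem when \<open>f\<close> induces a map from \<open>A\<close> to the group \<open>Z / N\<close> of
  order \<open>p\<close> whose fibres lie in left cosets of \<open>W\<close>.
\<close>
lemma card_le_index:
  assumes N: "subgroup N G" and Z: "subgroup Z G" "N \<subseteq> Z" "card Z = p * card N"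
    and A: "A \<subseteq> carrier G" and W: "subgroup W G" and f: "\<And>g. g \<in> A \<Longrightarrow> f g \<in> Z"
    and fW: "\<And>g h. g \<in> A \<Longrightarrow> h \<in> A \<Longrightarrow> inv (f g) \<otimes> f h \<in> N \<Longrightarrow> inv g \<otimes> h \<in> W"
  shows "card A \<le> p * card W"
proof -
  obtain R where R: "R \<subseteq> Z" "finite R" "card R \<le> p" "\<And>z. z \<in> Z \<Longrightarrow> \<exists>r\<in>R. \<exists>y\<in>N. z = r \<otimes> y"
    using coset_representatives[OF N Z] by blast
  define B where "B r = {g \<in> A. \<exists>y\<in>N. f g = r \<otimes> y}" for r
  have finA: "finite A" using A fin_carrier finite_subset by blast
  have cB: "card (B r) \<le> card W" if r: "r \<in> R" for r
  proof (cases "B r = {}")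
    case False
    then obtain g y where g: "g \<in> A" "y \<in> N" "f g = r \<otimes> y" by (auto simp: B_def)
    have rc: "r \<in> carrier G" using subgroup.mem_carrier[OF Z(1)] r R by blast
    have gc: "g \<in> carrier G" using g A by blast
    note Nc = subgroup.mem_carrier[OF N]
    have "B r \<subseteq> (\<lambda>w. g \<otimes> w) ` W"
    proof
      fix h assume "h \<in> B r"
      then obtain y' where h: "h \<in> A" "y' \<in> N" "f h = r \<otimes> y'" by (auto simp: B_def)
      have "inv (f g) \<otimes> f h = inv y \<otimes> (inv r \<otimes> r) \<otimes> y'"
        unfolding g(3) h(3) using rc Nc[OF g(2)] Nc[OF h(2)]
        by (simp only: inv_mult_group m_assoc m_closed inv_closed)
      also have "\<dots> = inv y \<otimes> y'" using rc Nc[OF g(2)] by simp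
      also have "\<dots> \<in> N" using g h N by (simp add: subgroup.m_closed subgroup.m_inv_closed)
      finally have "inv g \<otimes> h \<in> W" using fW g h by blast
      moreover have "h = g \<otimes> (inv g \<otimes> h)"
        using gc h(1) A by (auto simp: m_assoc[symmetric])
      ultimately show "h \<in> (\<lambda>w. g \<otimes> w) ` W" by blast
    qed
    then have "card (B r) \<le> card ((\<lambda>w. g \<otimes> w) ` W)"
      using fin_subgroup[OF W] by (intro card_mono) auto
    also have "\<dots> \<le> card W" using fin_subgroup[OF W] by (rule card_image_le)
    finally show ?thesis .
  qed simp
  have "A \<subseteq> (\<Union>r\<in>R. B r)" using f R(4) by (fastforce simp: B_def)
  then have "card A \<le> card (\<Union>r\<in>R. B r)"
    using R finA by (intro card_mono) (auto simp: B_def)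
  also have "\<dots> \<le> (\<Sum>r\<in>R. card (B r))" by (rule card_UN_le[OF R(2)])
  also have "\<dots> \<le> (\<Sum>r\<in>R. card W)" by (intro sum_mono cB)
  also have "\<dots> \<le> p * card W" using R by simp
  finally show ?thesis .
qed

lemma commutator_sym:
  assumes "N \<lhd> G" "x \<in> carrier G" "y \<in> carrier G"
  shows "commutator G x y \<in> N \<longleftrightarrow> commutator G y x \<in> N"
  unfolding commutator_mem_iff[OF assms] commutator_mem_iff[OF assms(1,3,2)] by (rule eq_commute)

lemma subgroup_centralizer_mod:
  assumes N: "N \<lhd> G" and A: "subgroup A G" and v: "v \<in> carrier G"
  shows "subgroup {g \<in> A. commutator G g v \<in> N} G"
proof -
  obtain Q :: "'a set monoid" and f where Q: "group_hom G Q f"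
    and ker: "\<And>x. x \<in> carrier G \<Longrightarrow> f x = \<one>\<^bsub>Q\<^esub> \<longleftrightarrow> x \<in> N"
    using quotient_hom[OF N] by metis
  interpret f: group_hom G Q f by fact
  note Ac = subgroup.mem_carrier[OF A]
  have iff: "commutator G g v \<in> N \<longleftrightarrow> f g \<otimes>\<^bsub>Q\<^esub> f v = f v \<otimes>\<^bsub>Q\<^esub> f g" if "g \<in> carrier G" for g
    using ker[of "commutator G g v"] f.commutator_trivial_iff[OF that v] that v by auto
  show ?thesis
  proof (rule finite_closed_imp_subgroup)
    show "\<one> \<in> {g \<in> A. commutator G g v \<in> N}"
      using subgroup.one_closed[OF A] iff[of \<one>] v by simp
    fix x y assume xy: "x \<in> {g \<in> A. commutator G g v \<in> N}" "y \<in> {g \<in> A. commutator G g v \<in> N}"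
    then have c: "x \<in> carrier G" "y \<in> carrier G" using Ac by auto
    have *: "f x \<otimes>\<^bsub>Q\<^esub> f v = f v \<otimes>\<^bsub>Q\<^esub> f x" "f y \<otimes>\<^bsub>Q\<^esub> f v = f v \<otimes>\<^bsub>Q\<^esub> f y"
      using xy iff c by auto
    have "f (x \<otimes> y) \<otimes>\<^bsub>Q\<^esub> f v = f x \<otimes>\<^bsub>Q\<^esub> (f y \<otimes>\<^bsub>Q\<^esub> f v)"
      using c v by (simp add: f.H.m_assoc)
    also have "\<dots> = (f x \<otimes>\<^bsub>Q\<^esub> f v) \<otimes>\<^bsub>Q\<^esub> f y"
      unfolding *(2) using c v by (simp add: f.H.m_assoc)
    also have "\<dots> = f v \<otimes>\<^bsub>Q\<^esub> f (x \<otimes> y)"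
      unfolding *(1) using c v by (simp add: f.H.m_assoc)
    finally show "x \<otimes> y \<in> {g \<in> A. commutator G g v \<in> N}"
      using xy iff[of "x \<otimes> y"] c A by (simp add: subgroup.m_closed)
  qed (use Ac in auto)
qed

text \<open>
  The map \<open>g \<mapsto> [g, v]\<close> takes values in \<open>Z\<close>, and \<open>[g, v] = [h, v]\<close> modulo \<open>N\<close> implies that
  \<open>inv g \<otimes> h\<close> centralises \<open>v\<close> modulo \<open>N\<close>.
\<close>
lemma card_centralizer_mod:
  assumes N: "N \<lhd> G" and Z: "subgroup Z G" "N \<subseteq> Z" "card Z = p * card N"
    and A: "subgroup A G" and v: "v \<in> carrier G" and AZ: "\<And>g. g \<in> A \<Longrightarrow> commutator G g v \<in> Z"
  shows "card A \<le> p * card {g \<in> A. commutator G g v \<in> N}"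
proof (rule card_le_index[OF normal_imp_subgroup[OF N] Z subgroup.subset[OF A]
      subgroup_centralizer_mod[OF N A v], where f = "\<lambda>g. commutator G g v"])
  obtain Q :: "'a set monoid" and f where Q: "group_hom G Q f"
    and ker: "\<And>x. x \<in> carrier G \<Longrightarrow> f x = \<one>\<^bsub>Q\<^esub> \<longleftrightarrow> x \<in> N"
    using quotient_hom[OF N] by metis
  interpret f: group_hom G Q f by fact
  fix g h assume g: "g \<in> A" and h: "h \<in> A" and *: "inv (commutator G g v) \<otimes> commutator G h v \<in> N"
  have c: "g \<in> carrier G" "h \<in> carrier G" using subgroup.mem_carrier[OF A] g h by auto
  have comm: "f (commutator G u v) = commutator Q (f u) (f v)" if "u \<in> carrier G" for u
    using that v by (simp add: commutator_def)
  have "f (inv (commutator G g v) \<otimes> commutator G h v) = \<one>\<^bsub>Q\<^esub>"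
    using ker[of "inv (commutator G g v) \<otimes> commutator G h v"] * c v by blast
  then have "inv\<^bsub>Q\<^esub> commutator Q (f g) (f v) \<otimes>\<^bsub>Q\<^esub> commutator Q (f h) (f v) = \<one>\<^bsub>Q\<^esub>"
    using c v by (simp add: comm)
  then have "commutator Q (f g) (f v) = commutator Q (f h) (f v)"
    using c v by (metis f.H.commutator_closed f.H.inv_closed f.H.inv_equality f.H.inv_inv f.hom_closed)
  then have "f (inv g \<otimes> h) \<otimes>\<^bsub>Q\<^esub> f v = f v \<otimes>\<^bsub>Q\<^esub> f (inv g \<otimes> h)"
    using f.H.conjugates_eq_imp_commute[of "f g" "f h" "f v"] c v by simp
  then have "commutator G (inv g \<otimes> h) v \<in> N"
    using f.commutator_trivial_iff[of "inv g \<otimes> h" v] ker[of "commutator G (inv g \<otimes> h) v"] c v by simp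
  then show "inv g \<otimes> h \<in> {g \<in> A. commutator G g v \<in> N}"
    using g h A by (simp add: subgroup.m_closed subgroup.m_inv_closed)
qed (rule AZ)

text \<open>
  A group with a central subgroup of index \<open>p\<close> is abelian: the centralizer of an element \<open>y\<close> outside
  \<open>C\<close> contains both \<open>C\<close> and \<open>y\<close>, so it is everything.
\<close>
lemma abelian_mod_of_central_index_p:
  assumes N: "N \<lhd> G" and C: "subgroup C G" and A: "subgroup A G" "C \<subseteq> A" "card A \<le> p * card C"
    and central: "\<And>c g. c \<in> C \<Longrightarrow> g \<in> A \<Longrightarrow> commutator G c g \<in> N"
    and xy: "x \<in> A" "y \<in> A"
  shows "commutator G x y \<in> N"
proof (cases "y \<in> C")
  case True
  then show ?thesis
    using central[OF True xy(1)] commutator_sym[OF N] xy subgroup.mem_carrier[OF A(1)] by blast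
next
  case False
  let ?B = "{g \<in> A. commutator G g y \<in> N}"
  have yc: "y \<in> carrier G" using subgroup.mem_carrier[OF A(1) xy(2)] .
  have B: "subgroup ?B G" by (rule subgroup_centralizer_mod[OF N A(1) yc])
  have "commutator G y y \<in> N"
    using yc subgroup.one_closed[OF normal_imp_subgroup[OF N]] by (simp add: commutator_def m_assoc)
  then have "C \<subset> ?B" using A(2) central xy False by auto
  then have "p * card C \<le> card ?B" by (rule card_proper_subgroup[OF C B])
  then have "?B = A" using A(3) fin_subgroup[OF A(1)] by (intro card_seteq) auto
  then show ?thesis using xy by blast
qed

lemma elementary_abelian_mod_of_index_p:
  assumes Z: "Z \<lhd> G" and ord: "order G = p * card Z"
  shows "elementary_abelian_mod G p Z (carrier G)"
proof -
  have Zs: "subgroup Z G" using normal_imp_subgroup[OF Z] .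
  obtain Q :: "'a set monoid" and f where Q: "group_hom G Q f"
    and ker: "\<And>x. x \<in> carrier G \<Longrightarrow> f x = \<one>\<^bsub>Q\<^esub> \<longleftrightarrow> x \<in> Z" and oQ: "order Q * card Z = order G"
    using quotient_hom[OF Z] by metis
  interpret f: group_hom G Q f by fact
  have oQ: "order Q = p" using oQ ord card_subgroup_pos[OF Zs] by simp
  have "x [^] p \<in> Z" if x: "x \<in> carrier G" for x
    using f.H.pow_order_eq_1[of "f x"] ker[of "x [^] p"] x oQ by (simp add: f.hom_nat_pow)
  moreover have "commutator G x y \<in> Z" if xy: "x \<in> carrier G" "y \<in> carrier G" for x y
  proof (rule abelian_mod_of_central_index_p[OF Z Zs subgroup_self])
    show "card (carrier G) \<le> p * card Z" using ord by (simp add: order_def)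
    show "commutator G c g \<in> Z" if c: "c \<in> Z" and g: "g \<in> carrier G" for c g
    proof -
      have "g \<otimes> inv c \<otimes> inv g \<in> Z"
        using normal.inv_op_closed2[OF Z g] subgroup.m_inv_closed[OF Zs c] by blast
      then have "c \<otimes> (g \<otimes> inv c \<otimes> inv g) \<in> Z" using c Zs by (simp add: subgroup.m_closed)
      then show ?thesis using g subgroup.mem_carrier[OF Zs c] by (simp add: commutator_def m_assoc)
    qed
  qed (use xy subgroup.subset[OF Zs] in auto)
  ultimately show ?thesis by (simp add: elementary_abelian_mod_def)
qed

text \<open>
  Here \<open>W\<close> is the hyperplane orthogonal to \<open>v\<close>, and \<open>Wu w\<close> is the part of it orthogonal to \<open>w\<close>, which
  has index \<open>p\<close> in \<open>W\<close> for \<open>w\<close> outside \<open>W\<close> because \<open>v\<close> belongs to \<open>W\<close> but not to \<open>Wu w\<close>.  An isotropic \<open>K\<close> that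
  contains \<open>w\<close> is determined by \<open>K \<inter> W\<close>, a subgroup of \<open>Wu w\<close>.  Counting the pairs of such a \<open>K\<close>
  and an element \<open>w\<close> of \<open>K\<close> outside \<open>W\<close> bounds the number of \<open>K\<close> that do not lie in \<open>W\<close>; the dual Pascal
  rule turns this bound into a difference of Gaussian binomials.
\<close>
lemma card_isotropic_nonabelian:
  assumes cs: "central_step G p N Z" and ord: "order G = p ^ Suc (Suc r) * card N"
    and el: "elementary_abelian_mod G p Z (carrier G)"
    and u: "u \<in> carrier G" and v: "v \<in> carrier G" and uv: "commutator G u v \<notin> N"
  shows "card {K \<in> subgroups_above G p Z (Suc j). elementary_abelian_mod G p N K} \<le> isotropic_bound p r (Suc j)"
proof -
  note D = central_stepD[OF cs]
  have commZ: "commutator G x y \<in> Z" if "x \<in> carrier G" "y \<in> carrier G" for x y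
    using el that by (simp add: elementary_abelian_mod_def)
  have cN: "card N > 0" using card_subgroup_pos[OF D(3)] .
  have cent: "commutator G z g \<in> N" if "z \<in> Z" "g \<in> carrier G" for z g
    using cs that by (simp add: central_step_def)
  define W where "W = {g \<in> carrier G. commutator G g v \<in> N}"
  have W: "subgroup W G" unfolding W_def by (rule subgroup_centralizer_mod[OF D(1) subgroup_self v])
  have Wc: "W \<subset> carrier G" using u uv by (auto simp: W_def)
  have ZW: "Z \<subseteq> W" using cent v subgroup.subset[OF D(4)] by (auto simp: W_def)
  have "order G \<le> p * card W"
    unfolding order_def W_def using commZ v by (intro card_centralizer_mod[OF D(1) D(4-6) subgroup_self v]) auto
  moreover have "p * card W \<le> order G"
    unfolding order_def by (rule card_proper_subgroup[OF W subgroup_self Wc])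
  ultimately have cW: "p * card W = order G" by simp
  then have cW': "card W = p ^ r * card Z" using ord D(6) p_pos by simp
  have vW: "v \<in> W" using v subgroup.one_closed[OF D(3)] by (simp add: W_def commutator_def m_assoc)
  define Wu where "Wu w = {g \<in> W. commutator G g w \<in> N}" for w
  have Wu: "subgroup (Wu w) G" "Z \<subseteq> Wu w" "p * card (Wu w) = card W" if w: "w \<in> carrier G" "w \<notin> W" for w
  proof -
    show S: "subgroup (Wu w) G" unfolding Wu_def by (rule subgroup_centralizer_mod[OF D(1) W w(1)])
    show "Z \<subseteq> Wu w" using ZW cent w by (auto simp: Wu_def)
    have "commutator G v w \<notin> N" using w v commutator_sym[OF D(1) v w(1)] by (simp add: W_def)
    then have "Wu w \<subset> W" using vW by (auto simp: Wu_def)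
    then have "p * card (Wu w) \<le> card W" by (rule card_proper_subgroup[OF S W])
    moreover have "card W \<le> p * card (Wu w)"
      unfolding Wu_def using commZ w subgroup.subset[OF W]
      by (intro card_centralizer_mod[OF D(1) D(4-6) W w(1)]) auto
    ultimately show "p * card (Wu w) = card W" by simp
  qed
  have uW: "u \<notin> W" using uv by (simp add: W_def)
  \<comment> \<open>a noncommutative quotient has order at least \<open>p ^ 3\<close>; here the reason is that \<open>Z\<close> fits into \<open>Wu u\<close>\<close>
  have "r \<noteq> 0"
  proof
    assume "r = 0"
    then have "card Z = p * card (Wu u)" using Wu(3)[OF u uW] cW' by simp
    moreover have "card Z \<le> card (Wu u)"
      by (rule card_mono[OF fin_subgroup[OF Wu(1)[OF u uW]] Wu(2)[OF u uW]])
    ultimately show False using p_gt_1 card_subgroup_pos[OF D(4)] by simp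
  qed
  then obtain s where s: "r = Suc s" using not0_implies_Suc by blast
  let ?A = "{K \<in> subgroups_above G p Z (Suc j). elementary_abelian_mod G p N K}"
  define S where "S = {K \<in> ?A. \<not> K \<subseteq> W}"
  have finS: "finite S" using fin_above by (simp add: S_def)
  have "?A \<subseteq> {K \<in> subgroups_above G p Z (Suc j). K \<subseteq> W} \<union> S" by (auto simp: S_def)
  then have "card ?A \<le> card ({K \<in> subgroups_above G p Z (Suc j). K \<subseteq> W} \<union> S)"
    using finS fin_above by (intro card_mono) auto
  also have "\<dots> \<le> card {K \<in> subgroups_above G p Z (Suc j). K \<subseteq> W} + card S"
    by (rule card_Un_le)
  also have "card {K \<in> subgroups_above G p Z (Suc j). K \<subseteq> W} \<le> gauss_binomial p r (Suc j)"
    by (rule card_above_within_le[OF D(2) W ZW cW'])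
  finally have main: "card ?A \<le> gauss_binomial p r (Suc j) + card S" by simp
  have KW: "subgroup (K \<inter> W) G" "p * card (K \<inter> W) = card K" "K \<inter> W \<in> subgroups_above G p Z j"
    if "K \<in> S" for K
  proof -
    have K: "subgroup K G" "Z \<subseteq> K" "card K = p ^ Suc j * card Z" "\<not> K \<subseteq> W"
      using that by (auto simp: S_def subgroups_above_def)
    show sub: "subgroup (K \<inter> W) G" using K W subgroups_Inter_pair by blast
    have "K \<inter> W = {g \<in> K. commutator G g v \<in> N}"
      using subgroup.subset[OF K(1)] by (auto simp: W_def)
    then have "card K \<le> p * card (K \<inter> W)"
      using commZ v subgroup.subset[OF K(1)] by (auto intro!: card_centralizer_mod[OF D(1) D(4-6) K(1) v])
    moreover have "p * card (K \<inter> W) \<le> card K"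
      using K(4) by (intro card_proper_subgroup[OF sub K(1)]) auto
    ultimately show *: "p * card (K \<inter> W) = card K" by simp
    then show "K \<inter> W \<in> subgroups_above G p Z j"
      using K(2,3) ZW sub p_pos by (simp add: subgroups_above_def)
  qed
  have cKW: "card (K - W) = (p - 1) * (p ^ j * card Z)" if K: "K \<in> S" for K
  proof -
    have "card (K \<inter> W) = p ^ j * card Z" using KW(3)[OF K] by (simp add: subgroups_above_def)
    moreover have "card (K - W) = card K - card (K \<inter> W)"
      using fin_subgroup KW(1)[OF K] by (simp add: card_Diff_subset_Int)
    ultimately show ?thesis
      using KW(2)[OF K] by (simp add: diff_mult_distrib)
  qed
  have fibre: "card {K \<in> S. w \<in> K} \<le> gauss_binomial p s j" if w: "w \<in> carrier G - W" for w
  proof -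
    have w: "w \<in> carrier G" "w \<notin> W" using that by auto
    have cWu: "card (Wu w) = p ^ s * card Z" using Wu(3)[OF w] cW' p_pos s by simp
    have "inj_on (\<lambda>K. K \<inter> W) {K \<in> S. w \<in> K}"
    proof (rule inj_onI)
      fix K K' assume "K \<in> {K \<in> S. w \<in> K}" "K' \<in> {K \<in> S. w \<in> K}" and e: "K \<inter> W = K' \<inter> W"
      then have K: "K \<in> S" "w \<in> K" and K': "K' \<in> S" "w \<in> K'" by auto
      have sub: "subgroup K G" "subgroup K' G" using K K' by (auto simp: S_def subgroups_above_def)
      have I: "subgroup (K \<inter> K') G" using sub subgroups_Inter_pair by blast
      have "K \<inter> W \<subset> K \<inter> K'" using e K K' w by auto
      then have le: "p * card (K \<inter> W) \<le> card (K \<inter> K')" by (rule card_proper_subgroup[OF KW(1)[OF K(1)] I])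
      have "K \<inter> K' = K"
        using le KW(2)[OF K(1)] fin_subgroup[OF sub(1)] by (intro card_seteq) auto
      moreover have "K \<inter> K' = K'"
        using le KW(2)[OF K'(1)] e fin_subgroup[OF sub(2)] by (intro card_seteq) auto
      ultimately show "K = K'" by simp
    qed
    then have "card {K \<in> S. w \<in> K} = card ((\<lambda>K. K \<inter> W) ` {K \<in> S. w \<in> K})"
      by (rule card_image[symmetric])
    also have "\<dots> \<le> card {L \<in> subgroups_above G p Z j. L \<subseteq> Wu w}"
    proof (rule card_mono)
      show "(\<lambda>K. K \<inter> W) ` {K \<in> S. w \<in> K} \<subseteq> {L \<in> subgroups_above G p Z j. L \<subseteq> Wu w}"
      proof clarify
        fix K assume K: "K \<in> S" "w \<in> K"
        have "K \<inter> W \<subseteq> Wu w" using K by (auto simp: S_def Wu_def elementary_abelian_mod_def)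
        then show "K \<inter> W \<in> subgroups_above G p Z j \<and> K \<inter> W \<subseteq> Wu w" using KW(3)[OF K(1)] by simp
      qed
    qed (use fin_above in simp)
    also have "\<dots> \<le> gauss_binomial p s j"
      by (rule card_above_within_le[OF D(2) Wu(1,2)[OF w] cWu])
    finally show ?thesis .
  qed
  have "card S * ((p - 1) * (p ^ j * card Z)) = (\<Sum>K\<in>S. card (K - W))" using cKW by simp
  also have "\<dots> = (\<Sum>K\<in>S. card {w \<in> carrier G - W. w \<in> K})"
  proof (rule sum.cong[OF refl])
    fix K assume "K \<in> S"
    then have "subgroup K G" by (auto simp: S_def subgroups_above_def)
    then have "K - W = {w \<in> carrier G - W. w \<in> K}" using subgroup.subset by blast
    then show "card (K - W) = card {w \<in> carrier G - W. w \<in> K}" by simp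
  qed
  also have "\<dots> = (\<Sum>w\<in>carrier G - W. card {K \<in> S. w \<in> K})"
    using finS fin_carrier by (intro sum_multicount_gen) auto
  also have "\<dots> \<le> (\<Sum>w\<in>carrier G - W. gauss_binomial p s j)" by (intro sum_mono fibre)
  also have "\<dots> = (order G - card W) * gauss_binomial p s j"
    using Wc fin_subgroup[OF W] by (simp add: card_Diff_subset order_def)
  also have "\<dots> = (p - 1) * (p ^ r * card Z) * gauss_binomial p s j"
    using cW cW' by (simp add: diff_mult_distrib)
  finally have "((p - 1) * card Z) * (card S * p ^ j) \<le> ((p - 1) * card Z) * (p ^ r * gauss_binomial p s j)"
    by (simp only: ac_simps)
  then have "p ^ j * card S \<le> p ^ r * gauss_binomial p s j"
    using p_gt_1 card_subgroup_pos[OF D(4)] by (simp add: mult.commute)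
  also have "\<dots> = p ^ j * (p * (gauss_binomial p r (Suc j) - gauss_binomial p s (Suc j)))"
  proof -
    have "p ^ j * (gauss_binomial p r (Suc j) - gauss_binomial p s (Suc j)) = p ^ s * gauss_binomial p s j"
      unfolding s diff_mult_distrib2 gauss_binomial_dual_Pascal by simp
    then show ?thesis by (simp add: s mult.left_commute del: gauss_binomial.simps)
  qed
  finally have "card S \<le> p * (gauss_binomial p r (Suc j) - gauss_binomial p s (Suc j))"
    using p_pos by simp
  then show ?thesis using main by (simp add: isotropic_bound_def s del: gauss_binomial.simps)
qed

text \<open>
  Taking \<open>p\<close>-th powers induces a nontrivial homomorphism from \<open>G / N\<close> to \<open>Z / N\<close>.  Its kernel \<open>W\<close> has
  index \<open>p\<close> and contains all \<open>K\<close> that are counted.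
\<close>
lemma card_isotropic_abelian:
  assumes cs: "central_step G p N Z" and ord: "order G = p ^ Suc (Suc r) * card N"
    and el: "elementary_abelian_mod G p Z (carrier G)"
    and ab: "\<And>x y. x \<in> carrier G \<Longrightarrow> y \<in> carrier G \<Longrightarrow> commutator G x y \<in> N"
    and x: "x \<in> carrier G" "x [^] p \<notin> N"
  shows "card {K \<in> subgroups_above G p Z k. elementary_abelian_mod G p N K} \<le> isotropic_bound p r k"
proof -
  note D = central_stepD[OF cs]
  obtain Q :: "'a set monoid" and f where Q: "group_hom G Q f"
    and ker: "\<And>x. x \<in> carrier G \<Longrightarrow> f x = \<one>\<^bsub>Q\<^esub> \<longleftrightarrow> x \<in> N"
    using quotient_hom[OF D(1)] by metis
  interpret f: group_hom G Q f by fact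
  have comm: "f a \<otimes>\<^bsub>Q\<^esub> f b = f b \<otimes>\<^bsub>Q\<^esub> f a" if "a \<in> carrier G" "b \<in> carrier G" for a b
    using ker[of "commutator G a b"] f.commutator_trivial_iff[OF that] that ab[OF that] by auto
  define W where "W = {g \<in> carrier G. g [^] p \<in> N}"
  have pow_iff: "g [^] p \<in> N \<longleftrightarrow> f g [^]\<^bsub>Q\<^esub> p = \<one>\<^bsub>Q\<^esub>" if "g \<in> carrier G" for g
    using ker[of "g [^] p"] that by (simp add: f.hom_nat_pow)
  have fp: "f (a \<otimes> b) [^]\<^bsub>Q\<^esub> p = f a [^]\<^bsub>Q\<^esub> p \<otimes>\<^bsub>Q\<^esub> f b [^]\<^bsub>Q\<^esub> p"
    if "a \<in> carrier G" "b \<in> carrier G" for a b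
    using that f.H.pow_mult_distrib[OF comm[OF that]] by simp
  have W: "subgroup W G"
  proof (rule finite_closed_imp_subgroup)
    show "\<one> \<in> W" using subgroup.one_closed[OF D(3)] by (simp add: W_def)
    show "a \<otimes> b \<in> W" if "a \<in> W" "b \<in> W" for a b
      using that pow_iff[of "a \<otimes> b"] pow_iff[of a] pow_iff[of b] fp[of a b] by (simp add: W_def)
  qed (auto simp: W_def)
  have "order G \<le> p * card W"
    unfolding order_def
  proof (rule card_le_index[OF D(3-6) subset_refl W, where f = "\<lambda>g. g [^] p"])
    show "g [^] p \<in> Z" if "g \<in> carrier G" for g using el that by (simp add: elementary_abelian_mod_def)
    fix g h assume c: "g \<in> carrier G" "h \<in> carrier G" and *: "inv (g [^] p) \<otimes> h [^] p \<in> N"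
    have "f (inv (g [^] p) \<otimes> h [^] p) = \<one>\<^bsub>Q\<^esub>" using ker[of "inv (g [^] p) \<otimes> h [^] p"] * c by simp
    moreover have "f (inv (g [^] p) \<otimes> h [^] p) = f (inv g) [^]\<^bsub>Q\<^esub> p \<otimes>\<^bsub>Q\<^esub> f h [^]\<^bsub>Q\<^esub> p"
      using c by (simp add: f.hom_nat_pow f.H.nat_pow_inv)
    ultimately have "f (inv g \<otimes> h) [^]\<^bsub>Q\<^esub> p = \<one>\<^bsub>Q\<^esub>" using fp[of "inv g" h] c by simp
    then show "inv g \<otimes> h \<in> W" using pow_iff[of "inv g \<otimes> h"] c by (simp add: W_def)
  qed
  moreover have "p * card W \<le> order G"
    unfolding order_def using x by (intro card_proper_subgroup[OF W subgroup_self]) (auto simp: W_def)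
  ultimately have "p * card W = order G" by simp
  then have cW: "card W = p ^ r * card Z" using ord D(6) p_pos by simp
  have ZW: "Z \<subseteq> W" using cs subgroup.subset[OF D(4)] by (auto simp: W_def central_step_def)
  have "{K \<in> subgroups_above G p Z k. elementary_abelian_mod G p N K} \<subseteq> {K \<in> subgroups_above G p Z k. K \<subseteq> W}"
    using subgroup.subset by (fastforce simp: W_def subgroups_above_def elementary_abelian_mod_def)
  then have "card {K \<in> subgroups_above G p Z k. elementary_abelian_mod G p N K} \<le> card {K \<in> subgroups_above G p Z k. K \<subseteq> W}"
    using fin_above by (intro card_mono) auto
  also have "\<dots> \<le> gauss_binomial p r k" by (rule card_above_within_le[OF D(2) W ZW cW])
  finally show ?thesis by (simp add: isotropic_bound_def)
qed

lemma card_isotropic: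
  assumes cs: "central_step G p N Z" and ord: "order G = p ^ Suc (Suc r) * card N"
    and el: "elementary_abelian_mod G p Z (carrier G)" and nel: "\<not> elementary_abelian_mod G p N (carrier G)"
  shows "card {K \<in> subgroups_above G p Z k. elementary_abelian_mod G p N K} \<le> isotropic_bound p r k"
proof (cases k)
  case 0
  have "card {K \<in> {Z}. elementary_abelian_mod G p N K} \<le> card {Z}" by (intro card_mono) auto
  then show ?thesis using 0 above_zero[OF central_stepD(4)[OF cs]] by simp
next
  case (Suc j)
  show ?thesis
  proof (cases "\<exists>u\<in>carrier G. \<exists>v\<in>carrier G. commutator G u v \<notin> N")
    case True
    then show ?thesis using card_isotropic_nonabelian[OF cs ord el] Suc by blast
  next
    case False
    then show ?thesis using nel card_isotropic_abelian[OF cs ord el] by (auto simp: elementary_abelian_mod_def)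
  qed
qed

lemma above_zero_bounds:
  assumes "subgroup N G"
  shows "card (subgroups_above G p N 0) \<le> 1" "card (elementary_subgroups_above G p N 0) \<le> 1"
proof -
  show "card (subgroups_above G p N 0) \<le> 1" using above_zero[OF assms] by simp
  have "card (elementary_subgroups_above G p N 0) \<le> card {N}"
    using above_zero[OF assms] by (intro card_mono) (auto simp: elementary_subgroups_above_def)
  then show "card (elementary_subgroups_above G p N 0) \<le> 1" by simp
qed

section \<open>The upper bound\<close>

text \<open>
  Both bounds are proved together, since the recursion for the number of all subgroups involves the
  number of elementary abelian ones.  If \<open>G / Z\<close> is not elementary abelian, the induction hypothesis
  applies to it; this forces \<open>r > 0\<close>, because a group of order \<open>p\<close> is elementary abelian.
\<close>
lemma card_above_le_bound:
  assumes "N \<lhd> G" "order G = p ^ Suc (Suc r) * card N" "\<not> elementary_abelian_mod G p N (carrier G)"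
  shows "card (subgroups_above G p N k) \<le> subgroups_bound p r k
    \<and> card (elementary_subgroups_above G p N k) \<le> elementary_bound p r k"
  using assms
proof (induction r arbitrary: N k rule: less_induct)
  case (less r N k)
  note nel = less.prems(3)
  obtain Z where cs: "central_step G p N Z" using central_step_exists less.prems by blast
  note D = central_stepD[OF cs]
  have oZ: "order G = p ^ Suc r * card Z" using less.prems(2) D(6) by simp
  show ?case
  proof (cases k)
    case 0
    then show ?thesis using above_zero_bounds[OF D(3)] by simp
  next
    case k: (Suc j)
    show ?thesis
    proof (cases "elementary_abelian_mod G p Z (carrier G)")
      case el: True
      note I = card_isotropic[OF cs less.prems(2) el nel]
      have "card (subgroups_above G p N k) \<le> card (subgroups_above G p Z j)
          + p ^ Suc j * card {K \<in> subgroups_above G p Z (Suc j). elementary_abelian_mod G p N K}"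
        using card_above_via_isotropic[OF cs el, of "Suc j"] unfolding k above_step[OF cs] .
      also have "\<dots> \<le> gauss_binomial p (Suc r) j + p ^ Suc j * isotropic_bound p r (Suc j)"
        by (intro add_mono mult_le_mono order_refl I card_above_le_gauss_binomial D(2) oZ)
      finally have 1: "card (subgroups_above G p N k) \<le> subgroups_bound p r k"
        by (simp add: k del: gauss_binomial.simps)
      have "card (elementary_subgroups_above G p N k) \<le> isotropic_bound p r j + p ^ Suc j * isotropic_bound p r (Suc j)"
        unfolding k by (rule order_trans[OF card_elementary_above_via_isotropic[OF cs el]]) (intro add_mono mult_le_mono order_refl I)
      then show ?thesis using 1 by (simp add: k)
    next
      case nelZ: False
      have "r \<noteq> 0"
      proof
        assume "r = 0"
        then have "order G = p * card Z" using oZ by simp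
        then show False using nelZ elementary_abelian_mod_of_index_p[OF D(2)] by blast
      qed
      then obtain s where s: "r = Suc s" using not0_implies_Suc by blast
      have IH: "card (subgroups_above G p Z i) \<le> subgroups_bound p s i"
        "card (elementary_subgroups_above G p Z i) \<le> elementary_bound p s i" for i
        using less.IH[of s Z i] s D(2) oZ nelZ by auto
      have "card (subgroups_above G p N k) \<le> subgroups_bound p s j
          + (p ^ Suc j - p ^ j) * card (elementary_subgroups_above G p Z (Suc j))
          + p ^ j * card (subgroups_above G p Z (Suc j))"
        unfolding k by (rule order_trans[OF card_above_rec[OF cs]]) (intro add_mono order_refl IH)
      also have "\<dots> \<le> subgroups_bound p r k"
        unfolding k s by (rule subgroups_bound_Suc[OF p_pos IH(2) IH(1)])
      finally have 1: "card (subgroups_above G p N k) \<le> subgroups_bound p r k" .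
      have "card (elementary_subgroups_above G p N k) \<le> elementary_bound p s j + p ^ Suc j * elementary_bound p s (Suc j)"
        unfolding k by (rule order_trans[OF card_elementary_above_rec[OF cs]]) (intro add_mono mult_le_mono order_refl IH)
      also have "\<dots> \<le> elementary_bound p r k"
        unfolding k s by (rule elementary_bound_Suc[OF p_pos])
      finally show ?thesis using 1 by simp
    qed
  qed
qed

lemma adjoin_in_elementary:
  assumes N: "subgroup N G" and A: "subgroup A G" "elementary_abelian_mod G p N A"
    and L: "subgroup L G" "N \<subseteq> L" "L \<subseteq> A" and u: "u \<in> A" "u \<notin> L"
  obtains H where "subgroup H G" "L \<subseteq> H" "u \<in> H" "H \<subseteq> A" "card H = p * card L"
proof -
  note Ac = subgroup.mem_carrier[OF A(1)]
  have uc: "u \<in> carrier G" using Ac u by blast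
  have "u \<otimes> y \<otimes> inv u \<in> L" if y: "y \<in> L" for y
  proof -
    have yc: "y \<in> carrier G" using subgroup.mem_carrier[OF L(1) y] .
    have "y \<in> A" using y L(3) by blast
    then have "commutator G u y \<in> L" using A(2) u(1) L(2) by (auto simp: elementary_abelian_mod_def)
    then have "commutator G u y \<otimes> y \<in> L" using y L by (simp add: subgroup.m_closed)
    then show ?thesis using uc yc by (simp add: commutator_def m_assoc)
  qed
  moreover have "u [^] p \<in> L" using A(2) u(1) L by (auto simp: elementary_abelian_mod_def)
  ultimately obtain H where H: "subgroup H G" "L \<subseteq> H" "u \<in> H" "card H = p * card L"
    "\<And>K. subgroup K G \<Longrightarrow> L \<subseteq> K \<Longrightarrow> u \<in> K \<Longrightarrow> H \<subseteq> K"
    using adjoin_element[OF L(1) uc u(2)] by metis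
  then show ?thesis using that[of H] A(1) L(3) u(1) by blast
qed

lemma elementary_chain:
  assumes N: "subgroup N G" and A: "subgroup A G" "N \<subseteq> A" "elementary_abelian_mod G p N A" "card A = p ^ m * card N"
  shows "i \<le> m \<Longrightarrow> \<exists>H. subgroup H G \<and> N \<subseteq> H \<and> H \<subseteq> A \<and> card H = p ^ i * card N"
proof (induction i)
  case 0
  then show ?case using N A by auto
next
  case (Suc i)
  then obtain L where L: "subgroup L G" "N \<subseteq> L" "L \<subseteq> A" "card L = p ^ i * card N" by auto
  have "p ^ i < p ^ m" using Suc.prems p_gt_1 by (intro power_strict_increasing) auto
  then have "L \<noteq> A" using L(4) A(4) card_subgroup_pos[OF N] by auto
  then obtain u where "u \<in> A" "u \<notin> L" using L by blast
  then obtain H where H: "subgroup H G" "L \<subseteq> H" "H \<subseteq> A" "card H = p * card L"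
    using adjoin_in_elementary[OF N A(1,3) L(1-3)] by metis
  moreover have "N \<subseteq> H" using H L by blast
  moreover have "card H = p ^ Suc i * card N" using H L by simp
  ultimately show ?case by blast
qed

section \<open>The lower bound for the extremal group\<close>

text \<open>
  Induction along a subgroup \<open>W\<close> of index \<open>p\<close> in \<open>A\<close>.  A subgroup \<open>L\<close> of \<open>W\<close> and an element \<open>w\<close> of \<open>A\<close>
  outside \<open>W\<close> generate a subgroup \<open>H\<close> with \<open>H \<inter> W = L\<close>.  Counting the pairs \<open>(w, H)\<close> gives the number of
  subgroups not contained in \<open>W\<close>, and the dual Pascal rule combines it with the number of subgroups
  of \<open>W\<close>.
\<close>
lemma card_elementary_ge_gauss_binomial:
  assumes N: "subgroup N G"
  shows "subgroup A G \<Longrightarrow> N \<subseteq> A \<Longrightarrow> elementary_abelian_mod G p N A \<Longrightarrow> card A = p ^ m * card N \<Longrightarrow>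
    gauss_binomial p m k \<le> card {H \<in> subgroups_above G p N k. H \<subseteq> A}"
proof (induction m arbitrary: A k)
  case 0
  show ?case
  proof (cases k)
    case k: 0
    have "{H \<in> {N}. H \<subseteq> A} = {N}" using 0 by auto
    then show ?thesis by (simp add: k above_zero[OF N])
  qed simp
next
  case (Suc m)
  note A = Suc.prems
  show ?case
  proof (cases k)
    case k: 0
    have "{H \<in> {N}. H \<subseteq> A} = {N}" using A by auto
    then show ?thesis by (simp add: k above_zero[OF N])
  next
    case k: (Suc j)
    obtain W where W: "subgroup W G" "N \<subseteq> W" "W \<subseteq> A" "card W = p ^ m * card N"
      using elementary_chain[OF N A, of m] by auto
    have elW: "elementary_abelian_mod G p N W" using elementary_abelian_mod_mono[OF A(3) order_refl W(3)] .
    have cAW: "card A = p * card W" using A(4) W(4) by simp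
    have cN: "card N > 0" using card_subgroup_pos[OF N] .
    define S where "S = {H \<in> subgroups_above G p N (Suc j). H \<subseteq> A \<and> \<not> H \<subseteq> W}"
    have finS: "finite S" unfolding S_def using fin_above by simp
    have cHW: "card (H - W) \<le> (p - 1) * (p ^ j * card N)" if "H \<in> S" for H
    proof -
      have H: "subgroup H G" "N \<subseteq> H" "card H = p ^ Suc j * card N" "H \<subseteq> A"
        using that by (auto simp: S_def subgroups_above_def)
      have "W <#> H \<subseteq> A"
        using W(3) H(4) A(1) by (auto simp: set_mult_def intro!: subgroup.m_closed[OF A(1)])
      then have "card (W <#> H) \<le> p * card W" unfolding cAW[symmetric] by (rule card_mono[OF fin_subgroup[OF A(1)]])
      then have "card (W <#> H) * card (W \<inter> H) \<le> p * card W * card (W \<inter> H)" by (rule mult_le_mono1)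
      then have "card W * card H \<le> card W * (p * card (W \<inter> H))"
        using card_set_mult[OF W(1) fin_subgroup[OF W(1)] H(1) fin_subgroup[OF H(1)]] by (simp only: ac_simps)
      then have "card H \<le> p * card (W \<inter> H)" using card_subgroup_pos[OF W(1)] by simp
      then have "p * (p ^ j * card N) \<le> p * card (W \<inter> H)" using H(3) by simp
      then have "p ^ j * card N \<le> card (W \<inter> H)" using p_pos by simp
      moreover have "card (H - W) = card H - card (W \<inter> H)"
        using fin_subgroup[OF H(1)] by (simp add: card_Diff_subset_Int Int_commute)
      ultimately show ?thesis using H(3) by (simp add: diff_mult_distrib)
    qed
    have fibre: "gauss_binomial p m j \<le> card {H \<in> S. w \<in> H}" if w: "w \<in> A - W" for w
    proof -
      let ?L = "{L \<in> subgroups_above G p N j. L \<subseteq> W}"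
      have ext: "\<exists>H. H \<in> S \<and> w \<in> H \<and> H \<inter> W = L" if "L \<in> ?L" for L
      proof -
        have L: "subgroup L G" "N \<subseteq> L" "L \<subseteq> W" "card L = p ^ j * card N"
          using that by (auto simp: subgroups_above_def)
        obtain H where H: "subgroup H G" "L \<subseteq> H" "w \<in> H" "H \<subseteq> A" "card H = p * card L"
          using adjoin_in_elementary[OF N A(1,3) L(1,2) _, of w] L(3) W(3) w by blast
        have I: "subgroup (H \<inter> W) G" using H W subgroups_Inter_pair by blast
        have "p * card (H \<inter> W) \<le> card H" using w H(3) by (intro card_proper_subgroup[OF I H(1)]) auto
        then have "card (H \<inter> W) \<le> card L" using H(5) p_pos by simp
        then have "L = H \<inter> W" using fin_subgroup[OF I] H(2) L(3) by (intro card_seteq) auto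
        moreover have "H \<in> S" using H L w by (auto simp: S_def subgroups_above_def)
        ultimately show ?thesis using H(3) by blast
      qed
      have "?L \<subseteq> (\<lambda>H. H \<inter> W) ` {H \<in> S. w \<in> H}" using ext by blast
      then have "card ?L \<le> card {H \<in> S. w \<in> H}" using finS by (intro surj_card_le) auto
      then show ?thesis using Suc.IH[OF W(1,2) elW W(4), of j] by linarith
    qed
    have "(p - 1) * (p ^ m * card N) * gauss_binomial p m j = (card A - card W) * gauss_binomial p m j"
      using A(4) W(4) by (simp add: diff_mult_distrib)
    also have "\<dots> = (\<Sum>w\<in>A - W. gauss_binomial p m j)"
      using W fin_subgroup[OF W(1)] by (simp add: card_Diff_subset)
    also have "\<dots> \<le> (\<Sum>w\<in>A - W. card {H \<in> S. w \<in> H})" by (intro sum_mono fibre)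
    also have "\<dots> = (\<Sum>H\<in>S. card {w \<in> A - W. w \<in> H})"
      using finS fin_subgroup[OF A(1)] by (intro sum_multicount_gen) auto
    also have "\<dots> \<le> (\<Sum>H\<in>S. (p - 1) * (p ^ j * card N))"
    proof (rule sum_mono)
      fix H assume H: "H \<in> S"
      then have "{w \<in> A - W. w \<in> H} = H - W" by (auto simp: S_def)
      then show "card {w \<in> A - W. w \<in> H} \<le> (p - 1) * (p ^ j * card N)" using cHW[OF H] by simp
    qed
    finally have "((p - 1) * card N) * (p ^ m * gauss_binomial p m j) \<le> ((p - 1) * card N) * (p ^ j * card S)"
      by (simp add: ac_simps)
    then have *: "p ^ m * gauss_binomial p m j \<le> p ^ j * card S"
      using p_gt_1 cN by simp
    have "p ^ j * gauss_binomial p (Suc m) (Suc j) = p ^ j * gauss_binomial p m (Suc j) + p ^ m * gauss_binomial p m j"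
      by (rule gauss_binomial_dual_Pascal)
    also have "\<dots> \<le> p ^ j * card {H \<in> subgroups_above G p N (Suc j). H \<subseteq> W} + p ^ j * card S"
      by (intro add_mono mult_le_mono order_refl Suc.IH W elW *)
    also have "\<dots> = p ^ j * card ({H \<in> subgroups_above G p N (Suc j). H \<subseteq> W} \<union> S)"
      using finS fin_above by (subst card_Un_disjoint) (auto simp: S_def algebra_simps)
    also have "{H \<in> subgroups_above G p N (Suc j). H \<subseteq> W} \<union> S = {H \<in> subgroups_above G p N (Suc j). H \<subseteq> A}"
      using W(3) by (auto simp: S_def)
    finally show ?thesis using p_pos by (simp add: k del: gauss_binomial.simps)
  qed
qed

lemma card_elementary_eq_gauss_binomial:
  assumes "N \<lhd> G" "subgroup A G" "N \<subseteq> A" "elementary_abelian_mod G p N A" "card A = p ^ m * card N"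
  shows "card {H \<in> subgroups_above G p N k. H \<subseteq> A} = gauss_binomial p m k"
  using card_elementary_ge_gauss_binomial[OF normal_imp_subgroup[OF assms(1)] assms(2-5), of k]
    card_above_within_le[OF assms(1-3,5), of k] by simp

lemma above_trivial_step:
  assumes "card Z = p"
  shows "{H \<in> subgroups_above G p {\<one>} (Suc k). Z \<subseteq> H} = subgroups_above G p Z k"
  using assms by (auto simp: subgroups_above_def subgroup.one_closed)

lemma card_elementary_not_above:
  assumes Z: "Z \<lhd> G" "card Z = p" and A: "subgroup A G" "Z \<subseteq> A" "elementary_abelian_mod G p {\<one>} A" "card A = p ^ Suc m"
  shows "card {H \<in> subgroups_above G p {\<one>} (Suc j). H \<subseteq> A \<and> \<not> Z \<subseteq> H} = p ^ Suc j * gauss_binomial p m (Suc j)"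
proof -
  let ?S = "{H \<in> subgroups_above G p {\<one>} (Suc j). H \<subseteq> A}"
  let ?T = "{H \<in> subgroups_above G p Z j. H \<subseteq> A}"
  have oneZ: "{\<one>} \<subseteq> Z" using subgroup.one_closed[OF normal_imp_subgroup[OF Z(1)]] by simp
  have oneA: "{\<one>} \<subseteq> A" using oneZ A(2) by blast
  have S: "card ?S = gauss_binomial p (Suc m) (Suc j)"
    using A by (intro card_elementary_eq_gauss_binomial[OF one_is_normal A(1) oneA A(3)]) simp
  have T: "card ?T = gauss_binomial p m j"
    using A Z elementary_abelian_mod_mono[OF A(3) oneZ order_refl] by (intro card_elementary_eq_gauss_binomial) auto
  have sub: "?T \<subseteq> ?S" using above_trivial_step[OF Z(2), of j] by blast
  have "{H \<in> subgroups_above G p {\<one>} (Suc j). H \<subseteq> A \<and> \<not> Z \<subseteq> H} = ?S - ?T"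
    using above_trivial_step[OF Z(2), of j] by blast
  moreover have "card (?S - ?T) = card ?S - card ?T"
    using sub fin_above by (intro card_Diff_subset) (auto intro: finite_subset)
  ultimately show ?thesis using S T by simp
qed

text \<open>
  The subgroups that contain \<open>Z\<close> correspond to those of the elementary abelian group \<open>G / Z\<close>.  Among
  those that do not contain \<open>Z\<close>, the lemma counts the ones in \<open>C\<close> and, for each of the \<open>p + 1\<close>
  subgroups \<open>W\<close> of index \<open>p\<close> above \<open>C\<close>, the ones that lie in \<open>W\<close> but not in \<open>C\<close>.  All these \<open>W\<close> are
  abelian, having a central subgroup of index \<open>p\<close>, and two of them meet in \<open>C\<close>, so no subgroup is
  counted twice.
\<close>
lemma bound_le_card_above:
  assumes expo: "\<And>x. x \<in> carrier G \<Longrightarrow> x [^] p = \<one>"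
    and Z: "Z \<lhd> G" "card Z = p" and C: "subgroup C G" "Z \<subseteq> C" "card C = p ^ Suc s"
    and ord: "order G = p ^ Suc (Suc (Suc s))"
    and central: "\<And>c g. c \<in> C \<Longrightarrow> g \<in> carrier G \<Longrightarrow> commutator G c g = \<one>"
    and comm: "\<And>x y. x \<in> carrier G \<Longrightarrow> y \<in> carrier G \<Longrightarrow> commutator G x y \<in> Z"
  shows "subgroups_bound p (Suc s) k \<le> card (subgroups_above G p {\<one>} k)"
proof (cases k)
  case 0
  then show ?thesis by (simp add: above_zero[OF triv_subgroup])
next
  case k: (Suc j)
  have oneZ: "\<one> \<in> Z" using subgroup.one_closed[OF normal_imp_subgroup[OF Z(1)]] .
  have Cc: "C \<subseteq> carrier G" using subgroup.subset[OF C(1)] .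
  let ?S = "subgroups_above G p {\<one>} (Suc j)"
  define T where "T A = {H \<in> ?S. H \<subseteq> A \<and> \<not> Z \<subseteq> H}" for A
  have elG: "elementary_abelian_mod G p Z (carrier G)" using expo oneZ comm by (simp add: elementary_abelian_mod_def)
  have elC: "elementary_abelian_mod G p {\<one>} C" using expo Cc central by (auto simp: elementary_abelian_mod_def)
  have 1: "card (subgroups_above G p Z j) = gauss_binomial p (Suc (Suc s)) j"
  proof -
    have "card {H \<in> subgroups_above G p Z j. H \<subseteq> carrier G} = gauss_binomial p (Suc (Suc s)) j"
      using Z ord Cc C(2) by (intro card_elementary_eq_gauss_binomial[OF Z(1) subgroup_self _ elG]) (auto simp: order_def)
    moreover have "{H \<in> subgroups_above G p Z j. H \<subseteq> carrier G} = subgroups_above G p Z j"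
      using subgroup.subset by (fastforce simp: subgroups_above_def)
    ultimately show ?thesis by simp
  qed
  have TC: "card (T C) = p ^ Suc j * gauss_binomial p s (Suc j)"
    unfolding T_def by (rule card_elementary_not_above[OF Z C(1,2) elC C(3)])
  define \<W> where "\<W> = subgroups_above G p C 1"
  have fW: "finite \<W>" unfolding \<W>_def by (rule fin_above)
  have W: "subgroup W G" "C \<subseteq> W" "card W = p ^ Suc (Suc s)" if "W \<in> \<W>" for W
    using that C(3) by (auto simp: \<W>_def subgroups_above_def)
  have cW: "1 + p \<le> card \<W>"
  proof -
    have "gauss_binomial p 2 1 \<le> card {H \<in> subgroups_above G p C 1. H \<subseteq> carrier G}"
      using elementary_abelian_mod_mono[OF elG C(2) order_refl] Cc ord C(3)
      by (intro card_elementary_ge_gauss_binomial C(1) subgroup_self) (auto simp: order_def power2_eq_square)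
    also have "\<dots> \<le> card \<W>" unfolding \<W>_def using fin_above by (intro card_mono) auto
    finally show ?thesis by (simp add: numeral_2_eq_2)
  qed
  have cTW: "card (T W - T C) = p ^ Suc j * (gauss_binomial p (Suc s) (Suc j) - gauss_binomial p s (Suc j))"
    if WW: "W \<in> \<W>" for W
  proof -
    have "commutator G x y \<in> {\<one>}" if "x \<in> W" "y \<in> W" for x y
    proof (rule abelian_mod_of_central_index_p[OF one_is_normal C(1) W(1,2)[OF WW]])
      show "card W \<le> p * card C" using W(3)[OF WW] C(3) by simp
      show "commutator G c g \<in> {\<one>}" if "c \<in> C" "g \<in> W" for c g
        using central that subgroup.subset[OF W(1)[OF WW]] by blast
    qed (use that in auto)
    then have elW: "elementary_abelian_mod G p {\<one>} W"
      using expo subgroup.subset[OF W(1)[OF WW]] by (auto simp: elementary_abelian_mod_def)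
    have ZW: "Z \<subseteq> W" using W(2)[OF WW] C(2) by blast
    have "card (T W) = p ^ Suc j * gauss_binomial p (Suc s) (Suc j)"
      unfolding T_def by (rule card_elementary_not_above[OF Z W(1)[OF WW] ZW elW W(3)[OF WW]])
    moreover have "T C \<subseteq> T W" using W(2)[OF WW] by (auto simp: T_def)
    then have "card (T W - T C) = card (T W) - card (T C)"
      using fin_above by (intro card_Diff_subset) (auto simp: T_def)
    ultimately show ?thesis using TC by (simp add: diff_mult_distrib2)
  qed
  have disj: "(T W - T C) \<inter> (T W' - T C) = {}" if WW: "W \<in> \<W>" "W' \<in> \<W>" "W \<noteq> W'" for W W'
  proof -
    have I: "subgroup (W \<inter> W') G" using W(1) WW subgroups_Inter_pair by blast
    have "W \<inter> W' \<noteq> W"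
    proof
      assume "W \<inter> W' = W"
      then have "W = W'" using W WW fin_subgroup[OF W(1)[OF WW(2)]] by (intro card_seteq) auto
      then show False using WW by simp
    qed
    then have "p * card (W \<inter> W') \<le> card W" by (intro card_proper_subgroup[OF I W(1)[OF WW(1)]]) auto
    then have "card (W \<inter> W') \<le> card C" using W(3)[OF WW(1)] C(3) p_pos by simp
    then have "C = W \<inter> W'" using W(2) WW fin_subgroup[OF I] by (intro card_seteq) auto
    then show ?thesis by (auto simp: T_def)
  qed
  let ?U = "\<Union>W\<in>\<W>. T W - T C"
  have fT: "finite (T A)" for A unfolding T_def using fin_above by simp
  have cU: "card ?U = (\<Sum>W\<in>\<W>. card (T W - T C))"
    using fW fT disj by (intro card_UN_disjoint) auto
  let ?d = "gauss_binomial p (Suc s) (Suc j) - gauss_binomial p s (Suc j)"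
  have "isotropic_bound p (Suc s) (Suc j) = gauss_binomial p s (Suc j) + (1 + p) * ?d"
    using gauss_binomial_mono_Suc[OF p_pos, of s "Suc j"] by (simp add: isotropic_bound_def del: gauss_binomial.simps)
  then have "subgroups_bound p (Suc s) (Suc j) = gauss_binomial p (Suc (Suc s)) j
      + (p ^ Suc j * gauss_binomial p s (Suc j) + (1 + p) * (p ^ Suc j * ?d))"
    by (simp add: algebra_simps del: gauss_binomial.simps)
  also have "\<dots> \<le> card (subgroups_above G p Z j) + (card (T C) + card \<W> * (p ^ Suc j * ?d))"
    using cW by (intro add_mono mult_le_mono) (simp_all add: 1 TC del: gauss_binomial.simps)
  also have "card \<W> * (p ^ Suc j * ?d) = card ?U"
    by (simp only: cU cTW sum_constant of_nat_id cong: sum.cong)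
  also have "card (T C) + card ?U = card (T C \<union> ?U)"
    using fT fW by (intro card_Un_disjoint[symmetric]) auto
  also have "card (subgroups_above G p Z j) + card (T C \<union> ?U) = card (subgroups_above G p Z j \<union> (T C \<union> ?U))"
    using fT fW fin_above by (intro card_Un_disjoint[symmetric]) (auto simp: T_def subgroups_above_def)
  also have "\<dots> \<le> card ?S"
    using above_trivial_step[OF Z(2), of j] fin_above by (intro card_mono) (auto simp: T_def)
  finally show ?thesis unfolding k .
qed

section \<open>Non-cyclic subgroups\<close>

lemma cyclic_of_card_le:
  assumes H: "subgroup H G" "card H \<le> p"
  shows "cyclic_group (G\<lparr>carrier := H\<rparr>)"
proof -
  interpret H: group "G\<lparr>carrier := H\<rparr>" using subgroup_imp_group[OF H(1)] .
  have "\<exists>x\<in>H. generate G {x} = H"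
  proof (cases "H = {\<one>}")
    case True
    then show ?thesis by (simp add: generate_one)
  next
    case False
    then obtain x where x: "x \<in> H" "x \<noteq> \<one>" using subgroup.one_closed[OF H(1)] by blast
    have xc: "x \<in> carrier G" using subgroup.mem_carrier[OF H(1) x(1)] .
    have g: "subgroup (generate G {x}) G" using xc by (intro generate_is_subgroup) auto
    have "x \<in> generate G {x}" by (intro generate.incl) simp
    then have "p * card {\<one>} \<le> card (generate G {x})"
      using x subgroup.one_closed[OF g] by (intro card_proper_subgroup[OF triv_subgroup g]) auto
    moreover have "generate G {x} \<subseteq> H" using x H by (intro generate_subgroup_incl) auto
    ultimately have "generate G {x} = H" using H(2) fin_subgroup[OF H(1)] by (intro card_seteq) auto
    then show ?thesis using x by blast
  qed
  then obtain x where x: "x \<in> H" "generate G {x} = H" by blast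
  have xc: "x \<in> carrier G" using subgroup.mem_carrier[OF H(1) x(1)] .
  have "H = range (\<lambda>n::int. x [^] n)" using generate_pow[OF xc] x(2) by auto
  then have "H = range (\<lambda>n::int. x [^]\<^bsub>G\<lparr>carrier := H\<rparr>\<^esub> n)"
    using int_pow_consistent[OF H(1) x(1)] by simp
  then show ?thesis unfolding H.cyclic_group using x(1) by auto
qed

lemma card_cyclic_le:
  assumes H: "subgroup H G" and cyc: "cyclic_group (G\<lparr>carrier := H\<rparr>)"
    and expo: "\<And>x. x \<in> carrier G \<Longrightarrow> x [^] p = \<one>"
  shows "card H \<le> p"
proof -
  interpret H: group "G\<lparr>carrier := H\<rparr>" using subgroup_imp_group[OF H] .
  obtain x where x: "x \<in> H" "H = range (\<lambda>n::int. x [^]\<^bsub>G\<lparr>carrier := H\<rparr>\<^esub> n)"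
    using cyc unfolding H.cyclic_group by auto
  have xc: "x \<in> carrier G" using subgroup.mem_carrier[OF H x(1)] .
  have "H = range (\<lambda>n::int. x [^] n)" using x(2) int_pow_consistent[OF H x(1)] by simp
  also have "\<dots> = generate G {x}" using generate_pow[OF xc] by auto
  finally have "card H = ord x" using generate_pow_card[OF xc] by simp
  moreover have "ord x dvd p" using pow_eq_id[OF xc] expo[OF xc] by blast
  ultimately show ?thesis using p_pos by (simp add: dvd_imp_le)
qed

lemma delta_le_sum: "delta G \<le> (\<Sum>k=2..n. card (subgroups_above G p {\<one>} k))"
proof -
  have "noncyclic_subgroups G \<subseteq> (\<Union>k\<in>{2..n}. subgroups_above G p {\<one>} k)"
  proof
    fix H assume "H \<in> noncyclic_subgroups G"
    then have H: "subgroup H G" "\<not> cyclic_group (G\<lparr>carrier := H\<rparr>)" by (auto simp: noncyclic_subgroups_def)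
    obtain i where i: "i \<le> n" "card H = p ^ i" using card_subgroup[OF H(1)] by blast
    have "p < card H" using cyclic_of_card_le[OF H(1)] H(2) by fastforce
    then have "p ^ 1 < p ^ i" using i by simp
    then have "1 < i" using p_gt_1 power_less_imp_less_exp by blast
    then show "H \<in> (\<Union>k\<in>{2..n}. subgroups_above G p {\<one>} k)"
      using H i by (auto simp: subgroups_above_def subgroup.one_closed intro!: bexI[of _ i])
  qed
  then have "delta G \<le> card (\<Union>k\<in>{2..n}. subgroups_above G p {\<one>} k)"
    unfolding delta_def using fin_above by (intro card_mono) auto
  also have "\<dots> \<le> (\<Sum>k=2..n. card (subgroups_above G p {\<one>} k))" by (rule card_UN_le) simp
  finally show ?thesis .
qed

lemma sum_le_delta:
  assumes expo: "\<And>x. x \<in> carrier G \<Longrightarrow> x [^] p = \<one>"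
  shows "(\<Sum>k=2..m. card (subgroups_above G p {\<one>} k)) \<le> delta G"
proof -
  have disj: "subgroups_above G p {\<one>} i \<inter> subgroups_above G p {\<one>} j = {}" if "i \<noteq> j" for i j
    using that p_gt_1 by (auto simp: subgroups_above_def)
  have "(\<Sum>k=2..m. card (subgroups_above G p {\<one>} k)) = card (\<Union>k\<in>{2..m}. subgroups_above G p {\<one>} k)"
    using fin_above disj by (intro card_UN_disjoint[symmetric]) auto
  also have "\<dots> \<le> card (noncyclic_subgroups G)"
  proof (rule card_mono)
    show "finite (noncyclic_subgroups G)"
      by (rule finite_subset[OF _ fin_subgroups]) (auto simp: noncyclic_subgroups_def)
    show "(\<Union>k\<in>{2..m}. subgroups_above G p {\<one>} k) \<subseteq> noncyclic_subgroups G"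
    proof
      fix H assume "H \<in> (\<Union>k\<in>{2..m}. subgroups_above G p {\<one>} k)"
      then obtain k where k: "k \<ge> 2" "subgroup H G" "card H = p ^ k" by (auto simp: subgroups_above_def)
      have "p ^ 1 < p ^ k" using k p_gt_1 by (intro power_strict_increasing) auto
      then have "\<not> cyclic_group (G\<lparr>carrier := H\<rparr>)" using card_cyclic_le[OF k(2) _ expo] k(3) by force
      then show "H \<in> noncyclic_subgroups G" using k by (simp add: noncyclic_subgroups_def)
    qed
  qed
  finally show ?thesis by (simp add: delta_def)
qed

lemma elementary_abelian_of_mod_one:
  assumes "elementary_abelian_mod G p {\<one>} (carrier G)"
  shows "elementary_abelian p G"
proof -
  have comm: "x \<otimes> y = y \<otimes> x" if xy: "x \<in> carrier G" "y \<in> carrier G" for x y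
  proof -
    have "commutator G x y \<in> {\<one>}" using assms xy by (simp add: elementary_abelian_mod_def)
    then have "{\<one>} #> (x \<otimes> y) = {\<one>} #> (y \<otimes> x)"
      using commutator_mem_iff[OF one_is_normal xy] by simp
    then show ?thesis using xy by (simp add: r_coset_def)
  qed
  have "comm_group G" using comm by (intro group_comm_groupI) auto
  moreover have "ord x = p" if "x \<in> carrier G" "x \<noteq> \<one>" for x
  proof -
    have "x [^] p = \<one>" using assms that by (auto simp: elementary_abelian_mod_def)
    then have "ord x dvd p" using pow_eq_id[OF that(1)] by blast
    moreover have "ord x \<noteq> 1" using that by (metis nat_pow_eone pow_ord_eq_1)
    ultimately show ?thesis using prime_p by (metis prime_nat_iff)
  qed
  ultimately show ?thesis by (simp add: elementary_abelian_def)
qed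

end

section \<open>The extremal group\<close>

text \<open>
  A central subgroup \<open>Z\<close> of order \<open>p\<close> contains all commutators, because the quotient by it has
  order \<open>p ^ 2\<close> and therefore a central subgroup of index \<open>p\<close>.
\<close>
lemma (in finite_p_group) order_cube_structure:
  assumes ord: "order G = p ^ 3"
  shows "\<exists>Z. central_step G p {\<one>} Z \<and> (\<forall>x\<in>carrier G. \<forall>y\<in>carrier G. commutator G x y \<in> Z)"
proof -
  have "order G = p ^ Suc 2 * card {\<one>}" using ord by (simp add: eval_nat_numeral)
  then obtain Z where cs: "central_step G p {\<one>} Z" using central_step_exists[OF one_is_normal] by blast
  note D = central_stepD[OF cs]
  have "order G = p ^ Suc 1 * card Z" using ord D(6) by (simp add: eval_nat_numeral)
  then obtain C where cs': "central_step G p Z C" using central_step_exists[OF D(2)] by blast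
  note D' = central_stepD[OF cs']
  have c: "card (carrier G) \<le> p * card C"
    using ord D(6) D'(6) by (simp add: order_def eval_nat_numeral)
  have "commutator G x y \<in> Z" if "x \<in> carrier G" "y \<in> carrier G" for x y
  proof (rule abelian_mod_of_central_index_p[OF D(2) D'(4) subgroup_self subgroup.subset[OF D'(4)] c])
    show "commutator G c g \<in> Z" if "c \<in> C" "g \<in> carrier G" for c g
      using cs' that by (simp add: central_step_def)
  qed (fact that)+
  then show ?thesis using cs by blast
qed

lemma cyclic_power_pow:
  assumes "x \<in> carrier (cyclic_power p d)"
  shows "x [^]\<^bsub>cyclic_power p d\<^esub> k = (\<lambda>i\<in>{..<d}. (int k * x i) mod int p)"
proof (induction k)
  case 0
  then show ?case by (simp add: cyclic_power_def)
next
  case (Suc k)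
  then show ?case by (auto simp: cyclic_power_def fun_eq_iff restrict_def mod_simps algebra_simps)
qed

lemma cyclic_power_facts:
  assumes p: "p > 0"
  shows "comm_group (cyclic_power p d)" "order (cyclic_power p d) = p ^ d"
    "\<And>x. x \<in> carrier (cyclic_power p d) \<Longrightarrow> x [^]\<^bsub>cyclic_power p d\<^esub> p = \<one>\<^bsub>cyclic_power p d\<^esub>"
proof -
  have "group (cyclic_power p d)" by (simp add: cyclic_power_def)
  then show "comm_group (cyclic_power p d)"
    by (rule group.group_comm_groupI) (simp add: cyclic_power_def add.commute)
  show "order (cyclic_power p d) = p ^ d"
    using p by (simp add: order_def cyclic_power_def card_PiE carrier_integer_mod_group)
  show "x [^]\<^bsub>cyclic_power p d\<^esub> p = \<one>\<^bsub>cyclic_power p d\<^esub>" if "x \<in> carrier (cyclic_power p d)" for x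
    unfolding cyclic_power_pow[OF that] by (simp add: cyclic_power_def)
qed

lemma DirProd_pow: "(a, b) [^]\<^bsub>G \<times>\<times> H\<^esub> (k::nat) = (a [^]\<^bsub>G\<^esub> k, b [^]\<^bsub>H\<^esub> k)"
  by (induction k) simp_all

lemma commutator_DirProd:
  assumes "group G" "group H" "a \<in> carrier G" "c \<in> carrier G" "b \<in> carrier H" "d \<in> carrier H"
  shows "commutator (G \<times>\<times> H) (a, b) (c, d) = (commutator G a c, commutator H b d)"
  using assms by (simp add: commutator_def)

lemma (in comm_group) commutator_eq_one: "x \<in> carrier G \<Longrightarrow> y \<in> carrier G \<Longrightarrow> commutator G x y = \<one>"
  unfolding commutator_def by (subst m_comm) (simp_all add: m_assoc)

text \<open>
  The exponent is a least element of a set of numbers, and this set contains the order of \<open>M\<close>, so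
  that the least element belongs to it.
\<close>
lemma Mp111_pow:
  assumes p: "Factorial_Ring.prime p" and M: "is_Mp111 p M" and x: "x \<in> carrier M"
  shows "x [^]\<^bsub>M\<^esub> p = \<one>\<^bsub>M\<^esub>"
proof -
  interpret M: group M using M by (simp add: is_Mp111_def)
  let ?P = "\<lambda>e::nat. 0 < e \<and> (\<forall>x\<in>carrier M. x [^]\<^bsub>M\<^esub> e = \<one>\<^bsub>M\<^esub>)"
  have "?P (p ^ 3)"
    using M p M.pow_order_eq_1 prime_gt_0_nat[OF p] by (auto simp: is_Mp111_def)
  then have "?P (LEAST e. ?P e)" by (rule LeastI[of ?P])
  moreover have "(LEAST e. ?P e) = p" using M by (simp add: is_Mp111_def group_exponent_def)
  ultimately show ?thesis using x by simp
qed

text \<open>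
  With a central subgroup \<open>Z\<close> of order \<open>p\<close> of \<open>M\<close> that contains all commutators, the subgroup \<open>Z \<times> C\<^sub>p ^ d\<close>
  is central of index \<open>p ^ 2\<close> in the product, and the product is abelian modulo \<open>Z \<times> 1\<close>.
\<close>
lemma subgroups_bound_le_card_above_target:
  fixes M :: "('c, 'd) monoid_scheme" and d :: nat
  assumes p: "Factorial_Ring.prime p" and M: "is_Mp111 p M"
  defines "D \<equiv> M \<times>\<times> cyclic_power p d"
  shows "finite_p_group D p (d + 3)" "\<And>x. x \<in> carrier D \<Longrightarrow> x [^]\<^bsub>D\<^esub> p = \<one>\<^bsub>D\<^esub>"
    "subgroups_bound p (Suc d) k \<le> card (subgroups_above D p {\<one>\<^bsub>D\<^esub>} k)"
proof -
  have gM: "group M" and oM: "order M = p ^ 3" using M by (simp_all add: is_Mp111_def)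
  have p0: "p > 0" using prime_gt_0_nat[OF p] .
  let ?E = "cyclic_power p d"
  note E = cyclic_power_facts[OF p0, where d = d]
  interpret E: comm_group ?E by (rule E(1))
  interpret M: finite_p_group M p 3
    using gM oM p by (simp add: finite_p_group_def finite_p_group_axioms_def)
  have gD: "group D" unfolding D_def by (rule DirProd_group[OF gM E.is_group])
  have oD: "order D = p ^ (d + 3)"
    using oM E(2) by (simp add: D_def order_def card_cartesian_product power_add)
  show D: "finite_p_group D p (d + 3)"
    using gD oD p by (simp add: finite_p_group_def finite_p_group_axioms_def)
  interpret D: finite_p_group D p "d + 3" by (rule D)
  show expo: "x [^]\<^bsub>D\<^esub> p = \<one>\<^bsub>D\<^esub>" if "x \<in> carrier D" for x
    using that Mp111_pow[OF p M] E(3) by (auto simp: D_def DirProd_pow)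
  obtain Z where cs: "central_step M p {\<one>\<^bsub>M\<^esub>} Z"
    and comm: "\<And>x y. x \<in> carrier M \<Longrightarrow> y \<in> carrier M \<Longrightarrow> commutator M x y \<in> Z"
    using M.order_cube_structure[OF oM] by blast
  note ZD = M.central_stepD[OF cs]
  have Zc: "Z \<subseteq> carrier M" using subgroup.subset[OF ZD(4)] .
  have cent: "commutator M z g = \<one>\<^bsub>M\<^esub>" if "z \<in> Z" "g \<in> carrier M" for z g
    using cs that by (simp add: central_step_def)
  show "subgroups_bound p (Suc d) k \<le> card (subgroups_above D p {\<one>\<^bsub>D\<^esub>} k)"
  proof (rule D.bound_le_card_above[OF expo])
    show "Z \<times> {\<one>\<^bsub>?E\<^esub>} \<lhd> D"
    proof (rule D.normal_invI)
      show "subgroup (Z \<times> {\<one>\<^bsub>?E\<^esub>}) D"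
        unfolding D_def by (rule DirProd_subgroups[OF gM ZD(4) E.is_group E.triv_subgroup])
      fix g h assume "g \<in> carrier D" "h \<in> Z \<times> {\<one>\<^bsub>?E\<^esub>}"
      then show "g \<otimes>\<^bsub>D\<^esub> h \<otimes>\<^bsub>D\<^esub> inv\<^bsub>D\<^esub> g \<in> Z \<times> {\<one>\<^bsub>?E\<^esub>}"
        using normal.inv_op_closed2[OF ZD(2)] gM E.is_group by (auto simp: D_def)
    qed
    show "card (Z \<times> {\<one>\<^bsub>?E\<^esub>}) = p" using ZD(6) by (simp add: card_cartesian_product)
    show "subgroup (Z \<times> carrier ?E) D"
      unfolding D_def by (rule DirProd_subgroups[OF gM ZD(4) E.is_group E.subgroup_self])
    show "Z \<times> {\<one>\<^bsub>?E\<^esub>} \<subseteq> Z \<times> carrier ?E" by auto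
    show "card (Z \<times> carrier ?E) = p ^ Suc d"
      using ZD(6) E(2) by (simp add: card_cartesian_product order_def)
    show "order D = p ^ Suc (Suc (Suc d))" using oD by (simp add: eval_nat_numeral)
    show "commutator D c g = \<one>\<^bsub>D\<^esub>" if "c \<in> Z \<times> carrier ?E" "g \<in> carrier D" for c g
    proof (cases c; cases g)
      fix c1 c2 g1 g2 assume "c = (c1, c2)" "g = (g1, g2)"
      then show ?thesis
        using that Zc cent[of c1 g1] E.commutator_eq_one[of c2 g2]
          commutator_DirProd[OF gM E.is_group, of c1 g1 c2 g2] by (auto simp: D_def)
    qed
    show "commutator D x y \<in> Z \<times> {\<one>\<^bsub>?E\<^esub>}" if "x \<in> carrier D" "y \<in> carrier D" for x y
    proof (cases x; cases y)
      fix x1 x2 y1 y2 assume "x = (x1, x2)" "y = (y1, y2)"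
      then show ?thesis
        using that comm[of x1 y1] E.commutator_eq_one[of x2 y2]
          commutator_DirProd[OF gM E.is_group, of x1 y1 x2 y2] by (auto simp: D_def)
    qed
  qed
qed

theorem theorem1p2:
  fixes p n :: nat
    and G :: "('a, 'b) monoid_scheme"
    and M :: "('c, 'd) monoid_scheme"
  assumes "Factorial_Ring.prime p" and "odd p" and "n \<ge> 3"
    and "group G" and "Coset.order G = p ^ n"
    and "\<not> elementary_abelian p G"
    and "is_Mp111 p M"
  shows "delta G \<le> delta (M \<times>\<times> cyclic_power p (n - 3))"
proof -
  interpret G: finite_p_group G p n
    using assms by (simp add: finite_p_group_def finite_p_group_axioms_def)
  obtain d where d: "n = d + 3" using \<open>n \<ge> 3\<close> by (metis le_add_diff_inverse2)
  let ?D = "M \<times>\<times> cyclic_power p d"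
  note target = subgroups_bound_le_card_above_target[OF assms(1,7), where d = d]
  have nel: "\<not> elementary_abelian_mod G p {\<one>\<^bsub>G\<^esub>} (carrier G)"
    using G.elementary_abelian_of_mod_one assms(6) by blast
  have ord: "order G = p ^ Suc (Suc (Suc d)) * card {\<one>\<^bsub>G\<^esub>}"
    using assms(5) by (simp add: d eval_nat_numeral)
  have "delta G \<le> (\<Sum>k=2..n. card (subgroups_above G p {\<one>\<^bsub>G\<^esub>} k))" by (rule G.delta_le_sum)
  also have "\<dots> \<le> (\<Sum>k=2..n. card (subgroups_above ?D p {\<one>\<^bsub>?D\<^esub>} k))"
    using G.card_above_le_bound[OF G.one_is_normal ord nel] target(3)
    by (intro sum_mono) (meson order_trans)
  also have "\<dots> \<le> delta ?D" by (rule finite_p_group.sum_le_delta[OF target(1,2)])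
  finally show ?thesis by (simp add: d)
qed

end
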